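(* Let $G$ be a nontrivial finite nilpotent group. Let $H$ be the direct product of the Sylow $q$-subgroups of $G$ over all primes $q$ dividing $|G|$ with $q \equiv 1 \pmod 3$, and let $K$ be the direct product of the Sylow $r$-subgroups of $G$ over all primes $r$ dividing $|G|$ with $r \equiv 2 \pmod 3$. Consider the three-player avoidance game on $G$. (1) Player 1 has a winning strategy in the following cases: (a) $|G| \equiv 1 \pmod 3$ and $2d(H) \geq d(K)+1$; (b) $|G| \equiv 2 \pmod 3$ and $2d(K) \geq d(H)+1$; (c) $|G| \equiv 3 \pmod 9$ and $d(G) = 1$. (2) Player 2 has a winning strategy in the following cases: (a) $|G| \equiv 1 \pmod 3$ and $2d(H) < d(K)+1$; (b) $|G| \equiv 2 \pmod 3$ and $2d(K) < d(H)+1$; (c) $|G| \equiv 6 \pmod 9$ and $d(G) \leq 2$. (3) Player 3 has a winning strategy in the following cases: (a) $|G| \equiv 0 \pmod 9$; (b) $|G| \equiv 3 \pmod 9$ and $d(G) \geq 2$; (c) $|G| \equiv 6 \pmod 9$ and $d(G) \geq 3$.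
   Context: For a finite group $G$, $d(G)$ denotes the minimum size of a generating set of $G$; the trivial group is generated by the empty set, so its value of $d$ is $0$. An empty direct product of Sylow subgroups is the trivial group. The three-player avoidance game on a nontrivial finite group $G$: Players 1, 2, 3 take turns in the cyclic order $1,2,3,1,2,3,\dots$, with Player 1 moving first. On each turn the player selects an element of $G$ that has not previously been selected by anyone. The game ends as soon as the set of all elements selected so far (by all players jointly) generates $G$. The player whose selection causes this is the loser (third place), the player who plays immediately before the loser in the cyclic order is the winner (first place), and the remaining player is the runner-up (second place). Thus if Player 1 wins, Player 3 is runner-up; if Player 2 wins, Player 1 is runner-up; if Player 3 wins, Player 2 is runner-up. Each player prefers winning to being runner-up, and being runner-up to losing; in particular, a player who cannot ensure victory for herself helps the opponent whose victory makes her runner-up. "Player $i$ has a winning strategy" means that Player $i$ is the winner when all three players play optimally with respect to these preferences, i.e. Player $i$ is the winner in the outcome determined by backward induction on this finite perfect-information game (this outcome is unique because each player's preference over the three possible winners is strict). *)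

theory Defs
  imports "HOL-Algebra.Algebra" "HOL-Number_Theory.Cong"
begin

definition commutator_subgroup :: "('a, 'b) monoid_scheme \<Rightarrow> 'a set \<Rightarrow> 'a set \<Rightarrow> 'a set" where
  "commutator_subgroup G A B =
     generate G {x \<otimes>\<^bsub>G\<^esub> y \<otimes>\<^bsub>G\<^esub> inv\<^bsub>G\<^esub> x \<otimes>\<^bsub>G\<^esub> inv\<^bsub>G\<^esub> y | x y. x \<in> A \<and> y \<in> B}"

primrec lower_central :: "('a, 'b) monoid_scheme \<Rightarrow> nat \<Rightarrow> 'a set" where
  "lower_central G 0 = carrier G"
| "lower_central G (Suc n) = commutator_subgroup G (lower_central G n) (carrier G)"

definition nilpotent_group :: "('a, 'b) monoid_scheme \<Rightarrow> bool" where
  "nilpotent_group G \<longleftrightarrow> group G \<and> (\<exists>n. lower_central G n = {\<one>\<^bsub>G\<^esub>})"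

definition sylow_subgroup :: "('a, 'b) monoid_scheme \<Rightarrow> nat \<Rightarrow> 'a set \<Rightarrow> bool" where
  "sylow_subgroup G p S \<longleftrightarrow> subgroup S G \<and> card S = p ^ multiplicity p (order G)"

definition min_gens :: "('a, 'b) monoid_scheme \<Rightarrow> nat" where
  "min_gens G = (LEAST n. \<exists>S. S \<subseteq> carrier G \<and> finite S \<and> card S = n \<and> generate G S = carrier G)"

datatype player = Player1 | Player2 | Player3

fun next_player :: "player \<Rightarrow> player" where
  "next_player Player1 = Player2"
| "next_player Player2 = Player3"
| "next_player Player3 = Player1"

fun prev_player :: "player \<Rightarrow> player" where
  "prev_player Player1 = Player3"
| "prev_player Player2 = Player1"
| "prev_player Player3 = Player2"

text \<open>
  The place (first, second or third) of player \<open>i\<close> when the winner is \<open>w\<close>: the loser moves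
  directly after the winner, so the runner-up is the player directly before the winner.
  A smaller place is preferred.
\<close>

definition place :: "player \<Rightarrow> player \<Rightarrow> nat" where
  "place w i = (if i = w then 1 else if i = prev_player w then 2 else 3)"

text \<open>
  \<open>avoidance_outcome G i S w\<close>: backward induction from the position in which the elements of
  \<open>S\<close> have been selected and it would be the turn of player \<open>i\<close> yields the winner \<open>w\<close>.
  If \<open>S\<close> generates \<open>G\<close>, the game is over, and the loser is the player before \<open>i\<close>, who made
  the last selection. Otherwise player \<open>i\<close> makes a selection \<open>x\<close> whose outcome gives her the
  best place among all selections \<open>y\<close> available to her.
\<close>

inductive avoidance_outcome ::
  "('a, 'b) monoid_scheme \<Rightarrow> player \<Rightarrow> 'a set \<Rightarrow> player \<Rightarrow> bool" for G where
  finished: "generate G S = carrier G \<Longrightarrow>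
    avoidance_outcome G i S (prev_player (prev_player i))"
| move: "\<lbrakk>generate G S \<noteq> carrier G; x \<in> carrier G - S;
    avoidance_outcome G (next_player i) (insert x S) w;
    \<forall>y \<in> carrier G - S. \<exists>v. avoidance_outcome G (next_player i) (insert y S) v \<and>
      place w i \<le> place v i\<rbrakk> \<Longrightarrow>
    avoidance_outcome G i S w"

definition has_winning_strategy :: "('a, 'b) monoid_scheme \<Rightarrow> player \<Rightarrow> bool" where
  "has_winning_strategy G i \<longleftrightarrow> avoidance_outcome G Player1 {} i"

text \<open>In a finite group, every position has exactly one outcome.\<close>

lemma place_inject: "place v i = place w i \<Longrightarrow> v = w"
  by (cases i; cases v; cases w) (simp_all add: place_def)

lemma avoidance_outcome_unique:
  "avoidance_outcome G i S w \<Longrightarrow> avoidance_outcome G i S w' \<Longrightarrow> w = w'"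
proof (induction arbitrary: w' rule: avoidance_outcome.induct)
  case (finished S i)
  from finished.prems finished.hyps show ?case
    by (cases rule: avoidance_outcome.cases) auto
next
  case (move S x i w)
  from move.prems show ?case
  proof (cases rule: avoidance_outcome.cases)
    case finished
    with move.hyps show ?thesis by simp
  next
    case (move x')
    obtain v where v: "\<And>v'. avoidance_outcome G (next_player i) (insert x' S) v' \<Longrightarrow> v = v'"
        "place w i \<le> place v i"
      using \<open>\<forall>y\<in>carrier G - S. \<exists>v. (avoidance_outcome G (next_player i) (insert y S) v \<and>
        (\<forall>w'. avoidance_outcome G (next_player i) (insert y S) w' \<longrightarrow> v = w')) \<and>
        place w i \<le> place v i\<close> move(2) by blast
    have le: "place w i \<le> place w' i"
      using v move(3) by blast
    obtain u where u: "avoidance_outcome G (next_player i) (insert x S) u"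
        "place w' i \<le> place u i"
      using move(4) \<open>x \<in> carrier G - S\<close> by blast
    have "w = u"
      using move.IH u(1) by blast
    with le u(2) show ?thesis
      by (intro place_inject) simp
  qed
qed

lemma (in group) avoidance_outcome_exists:
  assumes "finite (carrier G)" "S \<subseteq> carrier G"
  shows "\<exists>w. avoidance_outcome G i S w"
  using assms(2)
proof (induction "card (carrier G - S)" arbitrary: S i rule: less_induct)
  case less
  show ?case
  proof (cases "generate G S = carrier G")
    case True
    then show ?thesis using avoidance_outcome.finished by blast
  next
    case False
    have "\<exists>w. avoidance_outcome G (next_player i) (insert y S) w" if "y \<in> carrier G - S" for y
    proof (rule less.hyps)
      show "card (carrier G - insert y S) < card (carrier G - S)"
        using that assms(1) by (intro psubset_card_mono) auto
    qed (use that less.prems in auto)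
    then obtain f where f:
      "\<And>y. y \<in> carrier G - S \<Longrightarrow> avoidance_outcome G (next_player i) (insert y S) (f y)"
      by metis
    have "S \<noteq> carrier G"
      using False generate_incl[of S] generate.incl[of _ S G] by auto
    then have ne: "carrier G - S \<noteq> {}"
      using less.prems by auto
    obtain x where x: "x \<in> carrier G - S"
        "\<And>y. y \<in> carrier G - S \<Longrightarrow> place (f x) i \<le> place (f y) i"
      using ne ex_min_if_finite[of "(\<lambda>y. place (f y) i) ` (carrier G - S)"] assms(1)
      by (auto simp: not_less)
    show ?thesis
      using avoidance_outcome.move[OF False x(1) f[OF x(1)]] x(2) f by blast
  qed
qed

end

theory Submission
  imports Defs
begin

text \<open>
  A player who still has a safe selection never gains by ending the game, so it goes on until the
  selected elements form a maximal subgroup \<open>M\<close> and every selection loses. The winner is the player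
  who made the \<open>card M\<close>-th selection and depends only on \<open>card M\<close> modulo \<open>3\<close>. In a nilpotent group
  the index of \<open>M\<close> is a prime \<open>p\<close>, so the play is a fight about the residue of \<open>p\<close> modulo \<open>3\<close>, or about
  whether \<open>p = 3\<close> (lemmas \<open>nilpotent_maximal_index\<close> and \<open>outcome_from_maximal\<close>).
  
  In each case at most two players can be the winner, and each player prefers one of them. This
  splits the three players into a coalition and its opponents. The coalition reaches its goal if it
  rules out all maximal subgroups of the wrong indices before its opponents rule out those of the
  right ones. How far a set of selected elements is from ruling out the maximal subgroups with index
  in a set \<open>I\<close> of primes is measured by \<open>deficiency\<close>. No move lowers a deficiency by more than one,
  and because an element can be replaced by a power that lies in all maximal subgroups with index in
  a disjoint set \<open>J\<close>, a player can lower the deficiency of \<open>I\<close> by one without changing that of \<open>J\<close>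
  (\<open>deficiency_decrease\<close>). Hence the winner is found by counting moves (\<open>race\<close>).
  
  It remains to express the initial deficiencies by numbers of generators. For all primes together
  the deficiency of the empty set is \<open>min_gens G\<close>. For a set of primes dividing the order it is the number of
  generators of the product of the corresponding Sylow subgroups (\<open>min_gens_sylow_product\<close>). This
  needs the decomposition of \<open>G\<close> into Sylow subgroups, which follows from the fact that elements of
  coprime orders commute in a nilpotent group (\<open>nilpotent_coprime_commute\<close>).
\<close>

section \<open>Powers and membership in a subgroup\<close>

lemma (in group) subgroup_mult_left_mem_iff:
  assumes "subgroup M G" "x \<in> M" "y \<in> carrier G"
  shows "x \<otimes> y \<in> M \<longleftrightarrow> y \<in> M"
proof
  have x: "x \<in> carrier G"
    using assms subgroup.subset by blast
  assume "x \<otimes> y \<in> M"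
  then have "inv x \<otimes> (x \<otimes> y) \<in> M"
    using assms by (simp add: subgroup.m_closed subgroup.m_inv_closed)
  then show "y \<in> M"
    using x assms(3) by (simp flip: m_assoc)
qed (use assms in \<open>simp add: subgroup.m_closed\<close>)

lemma (in group) subgroup_mult_right_mem_iff:
  assumes "subgroup M G" "x \<in> M" "y \<in> carrier G"
  shows "y \<otimes> x \<in> M \<longleftrightarrow> y \<in> M"
proof
  have x: "x \<in> carrier G"
    using assms subgroup.subset by blast
  assume "y \<otimes> x \<in> M"
  then have "(y \<otimes> x) \<otimes> inv x \<in> M"
    using assms by (simp add: subgroup.m_closed subgroup.m_inv_closed)
  then show "y \<in> M"
    using x assms(3) by (simp add: m_assoc)
qed (use assms in \<open>simp add: subgroup.m_closed\<close>)

lemma (in group) subgroup_nat_pow_closed: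
  "subgroup M G \<Longrightarrow> x \<in> M \<Longrightarrow> x [^] (k::nat) \<in> M"
  by (induction k) (simp_all add: subgroup.one_closed subgroup.m_closed)

text \<open>
  If \<open>x\<close> has its \<open>p\<close>-th power in \<open>M\<close>, then membership of a power of \<open>x\<close> in \<open>M\<close> depends only on
  the exponent modulo \<open>p\<close>.
\<close>

lemma (in group) pow_mem_iff_cong:
  assumes M: "subgroup M G" and x: "x \<in> carrier G" "x [^] p \<in> M" and e: "[e = 1] (mod (p::nat))"
  shows "x [^] e \<in> M \<longleftrightarrow> x \<in> M"
proof -
  obtain k l where kl: "k * p + e = l * p + 1"
    using e by (metis cong_iff_lin_nat add.commute mult.commute)
  have "x [^] (k * p) \<in> M" "x [^] (l * p) \<in> M"
    using subgroup_nat_pow_closed[OF M x(2)] x(1) by (simp_all add: nat_pow_pow mult.commute)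
  moreover have "x [^] (k * p) \<otimes> x [^] e = x [^] (l * p) \<otimes> x"
    using x(1) kl by (simp add: nat_pow_mult)
  ultimately show ?thesis
    using subgroup_mult_left_mem_iff[OF M] x(1) by (metis nat_pow_closed)
qed

lemma (in group) coprime_pow_mem:
  assumes M: "subgroup M G" and x: "x \<in> carrier G" "x [^] a \<in> M" "x [^] b \<in> M"
    and ab: "coprime a (b::nat)"
  shows "x \<in> M"
proof -
  obtain u where "[a * u = 1] (mod b)"
    using cong_solve_coprime_nat[OF ab] by auto
  moreover have "x [^] (a * u) \<in> M"
    using subgroup_nat_pow_closed[OF M x(2)] x(1) by (simp add: nat_pow_pow)
  ultimately show ?thesis
    using pow_mem_iff_cong[OF M x(1,3)] by blast
qed

lemma (in group) pow_eq_one_coprime: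
  assumes "c \<in> carrier G" "c [^] a = \<one>" "c [^] b = \<one>" "coprime a (b::nat)"
  shows "c = \<one>"
  using coprime_pow_mem[OF triv_subgroup assms(1), of a b] assms by simp

section \<open>Elements of coprime order commute in a nilpotent group\<close>

lemma (in group) lower_central_normal: "lower_central G n \<lhd> G"
proof (induction n)
  case 0
  show ?case
    unfolding normal_inv_iff by (simp add: subgroup_self)
next
  case (Suc n)
  let ?L = "lower_central G n"
  let ?S = "{x \<otimes> y \<otimes> inv x \<otimes> inv y | x y. x \<in> ?L \<and> y \<in> carrier G}"
  have sub: "?L \<subseteq> carrier G"
    using Suc normal_imp_subgroup subgroup.subset by blast
  have conj_L: "g \<otimes> x \<otimes> inv g \<in> ?L" if "g \<in> carrier G" "x \<in> ?L" for g x
    using Suc that normal_inv_iff by blast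
  have "generate G ?S \<lhd> G"
  proof (rule normal_generateI)
    show "?S \<subseteq> carrier G"
      using sub by auto
  next
    fix h g assume "h \<in> ?S" and g: "g \<in> carrier G"
    then obtain x y where h: "h = x \<otimes> y \<otimes> inv x \<otimes> inv y" "x \<in> ?L" "y \<in> carrier G"
      by blast
    have x: "x \<in> carrier G"
      using h sub by blast
    define x' y' where "x' = g \<otimes> x \<otimes> inv g" and "y' = g \<otimes> y \<otimes> inv g"
    have "inv x' = g \<otimes> inv x \<otimes> inv g" "inv y' = g \<otimes> inv y \<otimes> inv g"
      unfolding x'_def y'_def using x h g by (simp_all add: inv_mult_group m_assoc)
    moreover have cancel: "a \<otimes> (inv g \<otimes> (g \<otimes> b)) = a \<otimes> b"
      if "a \<in> carrier G" "b \<in> carrier G" for a b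
      using that g by (simp flip: m_assoc)
    ultimately have "g \<otimes> h \<otimes> inv g = x' \<otimes> y' \<otimes> inv x' \<otimes> inv y'"
      unfolding x'_def y'_def h(1) using x h(3) g by (simp add: m_assoc cancel)
    moreover have "x' \<in> ?L" "y' \<in> carrier G"
      unfolding x'_def y'_def using conj_L h g by auto
    ultimately show "g \<otimes> h \<otimes> inv g \<in> ?S"
      by blast
  qed
  then show ?case
    by (simp add: commutator_subgroup_def)
qed

lemma (in group) lower_central_commutator:
  assumes "x \<in> lower_central G n" "y \<in> carrier G"
  shows "x \<otimes> y \<otimes> inv x \<otimes> inv y \<in> lower_central G (Suc n)"
  using assms by (auto simp: commutator_subgroup_def intro!: generate.incl)

text \<open>
  Moving \<open>y\<close> past one factor \<open>x\<close> costs one factor \<open>c\<close>, which can be collected in front because it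
  commutes with \<open>x\<close>. Hence the commutator of \<open>x [^] k\<close> with \<open>y\<close> is \<open>c [^] k\<close>.
\<close>

lemma (in group) pow_commute_up_to_central:
  assumes x: "x \<in> carrier G" and y: "y \<in> carrier G" and c: "c \<in> carrier G"
    and xy: "x \<otimes> y = c \<otimes> (y \<otimes> x)" and cx: "c \<otimes> x = x \<otimes> c"
  shows "x [^] (k::nat) \<otimes> y = c [^] k \<otimes> (y \<otimes> x [^] k)"
proof (induction k)
  case (Suc k)
  have comm: "x [^] j \<otimes> c = c \<otimes> x [^] j" for j :: nat
    using x c cx by (simp add: group_commutes_pow)
  have "x [^] Suc k \<otimes> y = x [^] k \<otimes> (x \<otimes> y)"
    using x y by (simp add: m_assoc)
  also have "\<dots> = (x [^] k \<otimes> c) \<otimes> (y \<otimes> x)"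
    using x y c by (simp add: xy m_assoc)
  also have "\<dots> = c \<otimes> (x [^] k \<otimes> y) \<otimes> x"
    using x y c by (simp add: comm m_assoc)
  also have "\<dots> = (c \<otimes> c [^] k) \<otimes> (y \<otimes> (x [^] k \<otimes> x))"
    using x y c by (simp add: Suc m_assoc)
  also have "\<dots> = c [^] Suc k \<otimes> (y \<otimes> x [^] Suc k)"
    using c by (metis nat_pow_Suc nat_pow_Suc2)
  finally show ?case .
qed (use x y in simp)

text \<open>
  By the collection formula, killing \<open>x\<close> by the exponent \<open>a\<close> kills the commutator \<open>c\<close> by the same
  exponent, and likewise for \<open>y\<close> and \<open>b\<close>; coprime exponents leave only \<open>c = \<one>\<close>.
\<close>

lemma (in group) central_commutator_trivial:
  assumes x: "x \<in> carrier G" "x [^] a = \<one>" and y: "y \<in> carrier G" "y [^] b = \<one>"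
    and ab: "coprime a (b::nat)" and c: "c \<in> carrier G"
    and xy: "x \<otimes> y = c \<otimes> (y \<otimes> x)" and cx: "c \<otimes> x = x \<otimes> c" and cy: "c \<otimes> y = y \<otimes> c"
  shows "c = \<one>"
proof -
  have "c [^] a = \<one>"
    using pow_commute_up_to_central[OF x(1) y(1) c xy cx, of a] x y c by simp
  moreover have "inv c [^] b = \<one>"
  proof -
    have "y \<otimes> x = inv c \<otimes> (x \<otimes> y)"
      using x y c xy by (simp add: inv_solve_left)
    moreover have "inv c \<otimes> y = y \<otimes> inv c"
      using y c cy by (metis inv_solve_left inv_solve_right m_assoc inv_closed m_closed)
    ultimately show ?thesis
      using pow_commute_up_to_central[of y x "inv c" b] x y c by simp
  qed
  then have "c [^] b = \<one>"
    using c by (simp add: nat_pow_inv inv_eq_1_iff)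
  ultimately show ?thesis
    using pow_eq_one_coprime c ab by blast
qed

text \<open>
  The commutator of \<open>x\<close> and \<open>y\<close> sinks through the whole lower central series. If it lies in one
  term, it is central modulo the next term, so there it is trivial because the orders are coprime,
  which places it in the next term. In particular, elements of Sylow subgroups for different primes
  commute.
\<close>

lemma (in group) nilpotent_coprime_commute:
  assumes nil: "nilpotent_group G"
    and x: "x \<in> carrier G" "x [^] a = \<one>" and y: "y \<in> carrier G" "y [^] b = \<one>"
    and ab: "coprime a (b::nat)"
  shows "x \<otimes> y = y \<otimes> x"
proof -
  define c where "c = x \<otimes> y \<otimes> inv x \<otimes> inv y"
  have c: "c \<in> carrier G"
    using x y by (simp add: c_def)
  have xy: "x \<otimes> y = c \<otimes> (y \<otimes> x)"
    using x y by (simp add: c_def m_assoc) (simp flip: m_assoc)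
  have step: "c \<in> lower_central G (Suc n)" if n: "c \<in> lower_central G n" for n
  proof -
    define N where "N = lower_central G (Suc n)"
    interpret N: normal N G
      unfolding N_def by (rule lower_central_normal)
    interpret Q: group "G Mod N"
      by (rule N.factorgroup_is_group)
    have mult: "(N #> u) \<otimes>\<^bsub>G Mod N\<^esub> (N #> v) = N #> (u \<otimes> v)"
      if "u \<in> carrier G" "v \<in> carrier G" for u v
      using that by (simp add: N.rcos_sum)
    have central: "N #> (c \<otimes> g) = N #> (g \<otimes> c)" if g: "g \<in> carrier G" for g
    proof -
      have "c \<otimes> g = (c \<otimes> g \<otimes> inv c \<otimes> inv g) \<otimes> (g \<otimes> c)"
        using c g by (simp add: m_assoc) (simp flip: m_assoc)
      then have "c \<otimes> g \<in> N #> (g \<otimes> c)"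
        using lower_central_commutator[OF n g] unfolding r_coset_def N_def by blast
      then show ?thesis
        using repr_independence N.is_subgroup c g by blast
    qed
    have "N #> c = \<one>\<^bsub>G Mod N\<^esub>"
    proof (rule Q.central_commutator_trivial[OF _ _ _ _ ab])
      show "(N #> x) [^]\<^bsub>G Mod N\<^esub> a = \<one>\<^bsub>G Mod N\<^esub>" "(N #> y) [^]\<^bsub>G Mod N\<^esub> b = \<one>\<^bsub>G Mod N\<^esub>"
        using x y N.subset by (simp_all only: N.FactGroup_pow one_FactGroup coset_mult_one)
      show "(N #> x) \<otimes>\<^bsub>G Mod N\<^esub> (N #> y)
          = (N #> c) \<otimes>\<^bsub>G Mod N\<^esub> ((N #> y) \<otimes>\<^bsub>G Mod N\<^esub> (N #> x))"
        using x y c by (simp only: mult m_closed flip: xy)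
    qed (use x y c central in \<open>simp_all only: mult\<close>, auto simp: carrier_FactGroup)
    then have "c \<in> N"
      using c coset_join1[of N c] N.is_subgroup by simp
    then show ?thesis
      unfolding N_def .
  qed
  have "c \<in> lower_central G n" for n
    by (induction n) (simp add: c, rule step)
  then have "c = \<one>"
    using nil unfolding nilpotent_group_def by auto
  then show ?thesis
    using xy x y by simp
qed

section \<open>Maximal subgroups of a finite nilpotent group\<close>

definition maximal_subgroup :: "('a, 'b) monoid_scheme \<Rightarrow> 'a set \<Rightarrow> bool" where
  "maximal_subgroup G M \<longleftrightarrow> subgroup M G \<and> M \<noteq> carrier G \<and>
     (\<forall>N. subgroup N G \<and> M \<subseteq> N \<longrightarrow> N = M \<or> N = carrier G)"

definition subgroup_index :: "('a, 'b) monoid_scheme \<Rightarrow> 'a set \<Rightarrow> nat" where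
  "subgroup_index G M = order G div card M"

lemma (in group) proper_subgroup_le_maximal:
  assumes "finite (carrier G)" "subgroup N G" "N \<noteq> carrier G"
  obtains M where "maximal_subgroup G M" "N \<subseteq> M"
proof -
  let ?A = "{M. subgroup M G \<and> M \<noteq> carrier G}"
  have "finite ?A"
    by (rule finite_subset[of _ "Pow (carrier G)"]) (auto dest: subgroup.subset simp: assms(1))
  moreover have "N \<in> ?A"
    using assms by simp
  ultimately obtain M where M: "M \<in> ?A" "N \<subseteq> M" "\<forall>B\<in>?A. M \<subseteq> B \<longrightarrow> M = B"
    using finite_has_maximal2[of ?A N] by blast
  then have "maximal_subgroup G M"
    unfolding maximal_subgroup_def by blast
  then show thesis
    using that M(2) by blast
qed

lemma (in group) generate_proper_iff:
  assumes "finite (carrier G)" "S \<subseteq> carrier G"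
  shows "generate G S \<noteq> carrier G \<longleftrightarrow> (\<exists>M. maximal_subgroup G M \<and> S \<subseteq> M)"
proof
  assume "generate G S \<noteq> carrier G"
  then obtain M where "maximal_subgroup G M" "generate G S \<subseteq> M"
    using proper_subgroup_le_maximal[OF assms(1) generate_is_subgroup[OF assms(2)]] by blast
  then show "\<exists>M. maximal_subgroup G M \<and> S \<subseteq> M"
    using generate.incl[of _ S G] by blast
next
  assume "\<exists>M. maximal_subgroup G M \<and> S \<subseteq> M"
  then obtain M where M: "subgroup M G" "M \<noteq> carrier G" "S \<subseteq> M"
    unfolding maximal_subgroup_def by blast
  then have "generate G S \<subseteq> M"
    using generate_subgroup_incl by blast
  then show "generate G S \<noteq> carrier G"
    using M subgroup.subset by blast
qed

text \<open>
  The condition on \<open>g\<close> is imposed on its inverse as well, which makes closure under inverses immediate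
  also for infinite \<open>M\<close>.
\<close>

lemma (in group) subgroup_normalizer:
  assumes "subgroup M G"
  shows "subgroup {g \<in> carrier G. \<forall>m\<in>M. g \<otimes> m \<otimes> inv g \<in> M \<and> inv g \<otimes> m \<otimes> g \<in> M} G"
    (is "subgroup ?N G")
proof
  have sub: "m \<in> carrier G" if "m \<in> M" for m
    using that assms subgroup.subset by blast
  show "x \<otimes> y \<in> ?N" if "x \<in> ?N" "y \<in> ?N" for x y
  proof -
    have xy: "x \<in> carrier G" "y \<in> carrier G"
      using that by auto
    have "x \<otimes> y \<otimes> m \<otimes> inv (x \<otimes> y) = x \<otimes> (y \<otimes> m \<otimes> inv y) \<otimes> inv x"
      "inv (x \<otimes> y) \<otimes> m \<otimes> (x \<otimes> y) = inv y \<otimes> (inv x \<otimes> m \<otimes> x) \<otimes> y" if "m \<in> M" for m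
      using xy sub[OF that] by (simp_all add: inv_mult_group m_assoc)
    then show ?thesis
      using that by simp
  qed
  show "\<one> \<in> ?N"
    using sub by simp
  show "inv x \<in> ?N" if "x \<in> ?N" for x
    using that by simp
  show "?N \<subseteq> carrier G"
    by blast
qed

text \<open>
  Take the last term of the lower central series that is not inside \<open>M\<close>. All its commutators with
  elements of \<open>M\<close> fall into the next term, hence into \<open>M\<close>, so that it normalizes \<open>M\<close>. The normalizer
  is thus strictly larger than \<open>M\<close> and, by maximality, everything.
\<close>

lemma (in group) nilpotent_maximal_normal:
  assumes nil: "nilpotent_group G" and max: "maximal_subgroup G M"
  shows "M \<lhd> G"
proof -
  have M: "subgroup M G" "M \<noteq> carrier G"
    using max unfolding maximal_subgroup_def by auto
  have sub: "m \<in> carrier G" if "m \<in> M" for m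
    using that M subgroup.subset by blast
  obtain k where "lower_central G k = {\<one>}"
    using nil unfolding nilpotent_group_def by blast
  then have "lower_central G k \<subseteq> M"
    using M subgroup.one_closed by fastforce
  moreover have "\<not> lower_central G 0 \<subseteq> M"
    using M subgroup.subset by fastforce
  ultimately obtain n where n: "\<not> lower_central G n \<subseteq> M" "lower_central G (Suc n) \<subseteq> M"
    using nat_induct[of "\<lambda>n. \<not> lower_central G n \<subseteq> M" k] by metis
  let ?N = "{g \<in> carrier G. \<forall>m\<in>M. g \<otimes> m \<otimes> inv g \<in> M \<and> inv g \<otimes> m \<otimes> g \<in> M}"
  have L: "subgroup (lower_central G n) G"
    using lower_central_normal normal_imp_subgroup by blast
  have conj: "g \<otimes> m \<otimes> inv g \<in> M" if "g \<in> lower_central G n" "m \<in> M" for g m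
  proof -
    have g: "g \<in> carrier G"
      using that L subgroup.subset by blast
    have "g \<otimes> m \<otimes> inv g \<otimes> inv m \<in> M"
      using lower_central_commutator[OF that(1) sub[OF that(2)]] n(2) by blast
    then have "(g \<otimes> m \<otimes> inv g \<otimes> inv m) \<otimes> m \<in> M"
      using subgroup.m_closed[OF M(1) _ that(2)] by blast
    then show ?thesis
      using g sub[OF that(2)] by (simp add: m_assoc)
  qed
  have "lower_central G n \<subseteq> ?N"
  proof
    fix g assume g: "g \<in> lower_central G n"
    then have "inv g \<in> lower_central G n" "g \<in> carrier G"
      using subgroup.m_inv_closed[OF L g] subgroup.mem_carrier[OF L g] by simp_all
    then show "g \<in> ?N"
      using conj[OF g] conj[of "inv g"] by simp
  qed
  then have "?N \<noteq> M"
    using n(1) by blast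
  moreover have "M \<subseteq> ?N"
    using sub subgroup.m_closed[OF M(1)] subgroup.m_inv_closed[OF M(1)] by (simp add: subset_iff)
  ultimately have "?N = carrier G"
    using max subgroup_normalizer[OF M(1)] unfolding maximal_subgroup_def by blast
  then show ?thesis
    unfolding normal_inv_iff using M(1) by blast
qed

text \<open>
  The quotient by \<open>M\<close> has a subgroup \<open>A\<close> of prime order \<open>p\<close>; its preimage \<open>\<Union>A\<close> lies strictly above
  \<open>M\<close> and therefore is the whole group, so that the quotient itself has order \<open>p\<close>. The last conclusion
  is the form in which normality is used later on: every \<open>p\<close>-th power lies in \<open>M\<close>.
\<close>

lemma (in group) nilpotent_maximal_index:
  assumes fin: "finite (carrier G)" and nil: "nilpotent_group G" and max: "maximal_subgroup G M"
  obtains p where "Factorial_Ring.prime p" "subgroup_index G M = p" "order G = p * card M"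
    "\<And>x. x \<in> carrier G \<Longrightarrow> x [^] p \<in> M"
proof -
  have M: "subgroup M G" "M \<noteq> carrier G"
    using max unfolding maximal_subgroup_def by auto
  interpret M: normal M G
    by (rule nilpotent_maximal_normal[OF nil max])
  let ?Q = "G Mod M"
  interpret Q: group ?Q
    by (rule M.factorgroup_is_group)
  have finQ: "finite (carrier ?Q)"
    using fin by (simp add: carrier_FactGroup)
  have "carrier ?Q \<noteq> {\<one>\<^bsub>?Q\<^esub>}"
    using M.fact_group_trivial_iff[OF fin] M(2) by simp
  then have "order ?Q \<noteq> 1"
    using Q.order_one_triv_iff by blast
  then obtain p where p: "Factorial_Ring.prime p" "p dvd order ?Q"
    using prime_factor_nat by blast
  then obtain m where "order ?Q = p ^ 1 * m"
    by (metis dvd_def power_one_right)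
  then obtain A where A: "subgroup A ?Q" "card A = p ^ 1"
    using sylow_thm[OF p(1) Q.group_axioms _ finQ] by blast
  have U: "\<Union>A = {x \<in> carrier G. M #> x \<in> A}"
    by (rule M.factgroup_subgroup_union_char[OF A(1)])
  have "M \<in> A"
    using subgroup.one_closed[OF A(1)] by simp
  then have "M \<subseteq> \<Union>A"
    by blast
  moreover have "\<Union>A \<noteq> M"
  proof
    assume eq: "\<Union>A = M"
    have "B = M" if "B \<in> A" for B
    proof -
      obtain x where "x \<in> carrier G" "B = M #> x"
        using \<open>B \<in> A\<close> subgroup.subset[OF A(1)] by (auto simp: carrier_FactGroup)
      moreover from this have "x \<in> M"
        using U eq \<open>B \<in> A\<close> by blast
      ultimately show ?thesis
        using coset_join2 M(1) by blast
    qed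
    then have "A \<subseteq> {M}"
      by blast
    then have "card A \<le> card {M}"
      by (intro card_mono) auto
    then show False
      using A(2) prime_ge_2_nat[OF p(1)] by simp
  qed
  ultimately have all: "\<Union>A = carrier G"
    using max M.factgroup_subgroup_union_subgroup[OF A(1)] unfolding maximal_subgroup_def by blast
  then have "carrier ?Q \<subseteq> A"
    using U by (auto simp: carrier_FactGroup)
  then have "carrier ?Q = A"
    using subgroup.subset[OF A(1)] by blast
  then have ordQ: "order ?Q = p"
    using A(2) by (simp add: order_def)
  have ord: "order G = p * card M"
    using lagrange[OF M(1)] ordQ by (simp add: FactGroup_def order_def)
  have "finite M"
    using fin M.subset finite_subset by blast
  moreover have "M \<noteq> {}"
    using M.one_closed by blast
  ultimately have "card M > 0"
    by (simp add: card_gt_0_iff)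
  then have "subgroup_index G M = p"
    by (simp add: subgroup_index_def ord)
  moreover have "x [^] p \<in> M" if x: "x \<in> carrier G" for x
  proof -
    have "M #> x [^] p = (M #> x) [^]\<^bsub>?Q\<^esub> order ?Q"
      using M.FactGroup_pow[OF x] ordQ by simp
    also have "\<dots> = M"
      using Q.pow_order_eq_1[of "M #> x"] x by (simp add: carrier_FactGroup)
    finally show ?thesis
      using coset_join1 M(1) x by simp
  qed
  ultimately show thesis
    using that p(1) ord by blast
qed

locale finite_nilpotent_group = group G for G (structure) +
  assumes finite: "finite (carrier G)"
    and nilpotent: "nilpotent_group G"

section \<open>Distance of a set from escaping all maximal subgroups of given indices\<close>

text \<open>
  For a set \<open>I\<close> of primes, a set \<open>S\<close> fills \<open>I\<close> if no maximal subgroup with index in \<open>I\<close> is left above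
  \<open>S\<close>. In a finite nilpotent group this means that \<open>S\<close> projects onto generators of the \<open>I\<close>-part of the
  group; the formulation by maximal subgroups avoids these projections and is also what decides the
  game.
\<close>

definition fills :: "('a, 'b) monoid_scheme \<Rightarrow> nat set \<Rightarrow> 'a set \<Rightarrow> bool" where
  "fills G I S \<longleftrightarrow> (\<forall>M. maximal_subgroup G M \<and> S \<subseteq> M \<longrightarrow> subgroup_index G M \<notin> I)"

text \<open>
  The least number of further elements with which \<open>S\<close> fills \<open>I\<close>; this is what a coalition still has to
  select.
\<close>

definition deficiency :: "('a, 'b) monoid_scheme \<Rightarrow> nat set \<Rightarrow> 'a set \<Rightarrow> nat" where
  "deficiency G I S =
     (LEAST n. \<exists>T. T \<subseteq> carrier G \<and> finite T \<and> card T = n \<and> fills G I (S \<union> T))"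

lemma fills_mono: "fills G I S \<Longrightarrow> S \<subseteq> T \<Longrightarrow> J \<subseteq> I \<Longrightarrow> fills G J T"
  unfolding fills_def by blast

lemma deficiency_le:
  assumes "T \<subseteq> carrier G" "finite T" "fills G I (S \<union> T)"
  shows "deficiency G I S \<le> card T"
  unfolding deficiency_def using assms by (intro Least_le) blast

context finite_nilpotent_group
begin

lemma fills_carrier: "fills G I (carrier G)"
  unfolding fills_def maximal_subgroup_def using subgroup.subset by blast

lemma fills_UNIV: "S \<subseteq> carrier G \<Longrightarrow> fills G UNIV S \<longleftrightarrow> generate G S = carrier G"
  using generate_proper_iff[OF finite] unfolding fills_def by blast

lemma deficiency_witness:
  assumes "S \<subseteq> carrier G"
  obtains T where "T \<subseteq> carrier G" "finite T" "card T = deficiency G I S" "fills G I (S \<union> T)"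
proof -
  have "\<exists>n T. T \<subseteq> carrier G \<and> finite T \<and> card T = n \<and> fills G I (S \<union> T)"
    using finite fills_carrier assms by (metis Un_absorb1 order_refl)
  from LeastI_ex[OF this] show thesis
    unfolding deficiency_def[symmetric] using that by blast
qed

lemma deficiency_eq_0: "S \<subseteq> carrier G \<Longrightarrow> deficiency G I S = 0 \<longleftrightarrow> fills G I S"
  using deficiency_witness[of S I] deficiency_le[of "{}" G I S]
  by (metis Un_empty_right card_eq_0_iff empty_subsetI finite.emptyI le_zero_eq)

lemma deficiency_mono:
  assumes "S \<subseteq> T" "T \<subseteq> carrier G" "J \<subseteq> I"
  shows "deficiency G J T \<le> deficiency G I S"
proof -
  obtain U where U: "U \<subseteq> carrier G" "finite U" "card U = deficiency G I S" "fills G I (S \<union> U)"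
    using deficiency_witness assms by (metis order_trans)
  then have "fills G J (T \<union> U)"
    using fills_mono assms by (metis Un_mono order_refl)
  then show ?thesis
    using deficiency_le U by metis
qed

lemma deficiency_insert:
  assumes "S \<subseteq> carrier G" "x \<in> carrier G"
  shows "deficiency G I S \<le> Suc (deficiency G I (insert x S))"
proof -
  obtain U where U: "U \<subseteq> carrier G" "finite U" "card U = deficiency G I (insert x S)"
    "fills G I (insert x S \<union> U)"
    using deficiency_witness[of "insert x S"] assms by blast
  then have "deficiency G I S \<le> card (insert x U)"
    using assms by (intro deficiency_le) auto
  also have "\<dots> \<le> Suc (card U)"
    by (rule card_insert_le_m1) simp_all
  finally show ?thesis
    using U(3) by simp
qed

lemma min_gens_eq_deficiency: "min_gens G = deficiency G UNIV {}"
proof -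
  have "S \<subseteq> carrier G \<and> finite S \<and> card S = n \<and> generate G S = carrier G \<longleftrightarrow>
    S \<subseteq> carrier G \<and> finite S \<and> card S = n \<and> fills G UNIV ({} \<union> S)" for S n
    using fills_UNIV[of S] by auto
  then show ?thesis
    unfolding min_gens_def deficiency_def by simp
qed

text \<open>
  The witness \<open>x'\<close> is the power \<open>x [^] e\<close> whose exponent is \<open>1\<close> modulo all primes in \<open>I\<close> that
  divide the order of \<open>G\<close>, and \<open>0\<close> modulo those in \<open>J\<close>. It plays the role of the \<open>I\<close>-part of \<open>x\<close>: a maximal subgroup of prime index \<open>p\<close>
  contains all \<open>p\<close>-th powers, so that it only sees the exponent modulo \<open>p\<close>.
\<close>

lemma prime_part:
  assumes IJ: "I \<inter> J = {}" and x: "x \<in> carrier G"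
  obtains x' where "x' \<in> carrier G"
    "\<And>M. maximal_subgroup G M \<Longrightarrow> subgroup_index G M \<in> I \<Longrightarrow> x' \<in> M \<longleftrightarrow> x \<in> M"
    "\<And>M. maximal_subgroup G M \<Longrightarrow> subgroup_index G M \<in> J \<Longrightarrow> x' \<in> M"
proof -
  let ?P = "{p. Factorial_Ring.prime p \<and> p dvd order G}"
  have ord: "order G \<noteq> 0"
    using finite order_gt_0_iff_finite by simp
  have finP: "finite ?P"
    using finite_divisors_nat[of "order G"] ord by simp
  define u where "u = \<Prod>(I \<inter> ?P)"
  define v where "v = \<Prod>(J \<inter> ?P)"
  have "coprime u v"
    unfolding u_def v_def using IJ by (intro prod_coprime_left prod_coprime_right primes_coprime) auto
  then obtain e where e: "[e = 1] (mod u)" "[e = 0] (mod v)"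
    using binary_chinese_remainder_nat by blast
  have "v dvd e"
    using e(2) by (simp add: cong_0_iff)
  show thesis
  proof (rule that)
    show "x [^] e \<in> carrier G"
      using x by simp
  next
    fix M assume M: "maximal_subgroup G M" "subgroup_index G M \<in> I"
    obtain p where p: "Factorial_Ring.prime p" "subgroup_index G M = p" "order G = p * card M"
      "x [^] p \<in> M"
      using nilpotent_maximal_index[OF finite nilpotent M(1)] x by metis
    have sub: "subgroup M G"
      using M unfolding maximal_subgroup_def by blast
    have "p dvd u"
      unfolding u_def using finP M p by (intro dvd_prodI) auto
    then have "[e = 1] (mod p)"
      using e(1) cong_dvd_modulus_nat by blast
    then show "x [^] e \<in> M \<longleftrightarrow> x \<in> M"
      by (rule pow_mem_iff_cong[OF sub x p(4)])
  next
    fix M assume M: "maximal_subgroup G M" "subgroup_index G M \<in> J"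
    obtain p where p: "Factorial_Ring.prime p" "subgroup_index G M = p" "order G = p * card M"
      "x [^] p \<in> M"
      using nilpotent_maximal_index[OF finite nilpotent M(1)] x by metis
    have sub: "subgroup M G"
      using M unfolding maximal_subgroup_def by blast
    have "p dvd v"
      unfolding v_def using finP M p by (intro dvd_prodI) auto
    then obtain k where "e = p * k"
      using \<open>v dvd e\<close> by (meson dvd_def dvd_trans)
    then have "x [^] e = (x [^] p) [^] k"
      using x by (simp add: nat_pow_pow)
    then show "x [^] e \<in> M"
      using subgroup_nat_pow_closed[OF sub p(4)] by simp
  qed
qed

text \<open>
  Some selection brings a coalition one step closer to filling \<open>I\<close> without any progress towards
  filling \<open>J\<close>: take one element of an optimal completion and replace it by its \<open>I\<close>-part.
\<close>

lemma deficiency_decrease: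
  assumes S: "S \<subseteq> carrier G" and IJ: "I \<inter> J = {}" and pos: "0 < deficiency G I S"
  obtains x where "x \<in> carrier G" "deficiency G I (insert x S) < deficiency G I S"
    "\<And>M. maximal_subgroup G M \<Longrightarrow> subgroup_index G M \<in> J \<Longrightarrow> x \<in> M"
proof -
  obtain T where T: "T \<subseteq> carrier G" "finite T" "card T = deficiency G I S" "fills G I (S \<union> T)"
    using deficiency_witness[OF S] by blast
  then have "T \<noteq> {}"
    using pos by auto
  then obtain x where x: "x \<in> T"
    by blast
  obtain x' where x': "x' \<in> carrier G"
    "\<And>M. maximal_subgroup G M \<Longrightarrow> subgroup_index G M \<in> I \<Longrightarrow> x' \<in> M \<longleftrightarrow> x \<in> M"
    "\<And>M. maximal_subgroup G M \<Longrightarrow> subgroup_index G M \<in> J \<Longrightarrow> x' \<in> M"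
    using prime_part[OF IJ, of x] x T(1) by blast
  have "fills G I (insert x' S \<union> (T - {x}))"
    unfolding fills_def
  proof (intro allI impI notI, elim conjE)
    fix M assume M: "maximal_subgroup G M" "insert x' S \<union> (T - {x}) \<subseteq> M" "subgroup_index G M \<in> I"
    then have "S \<union> T \<subseteq> M"
      using x'(2) by blast
    then show False
      using T(4) M unfolding fills_def by blast
  qed
  then have "deficiency G I (insert x' S) \<le> card (T - {x})"
    using T by (intro deficiency_le) auto
  also have "\<dots> < card T"
    using x T(2) by (intro psubset_card_mono) auto
  finally show thesis
    using that x' T(3) by simp
qed

lemma deficiency_insert_neutral:
  assumes "\<And>M. maximal_subgroup G M \<Longrightarrow> subgroup_index G M \<in> J \<Longrightarrow> x \<in> M"
  shows "deficiency G J (insert x S) = deficiency G J S"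
proof -
  have "fills G J (insert x S \<union> T) \<longleftrightarrow> fills G J (S \<union> T)" for T
    unfolding fills_def using assms by blast
  then show ?thesis
    unfolding deficiency_def by simp
qed

text \<open>
  Disjoint sets of primes can be served by the same elements: if \<open>x\<close> makes progress on \<open>I\<close> and is
  neutral for \<open>J\<close>, and \<open>y\<close> makes progress on \<open>J\<close> and is neutral for \<open>I\<close>, then \<open>x \<otimes> y\<close> makes progress
  on both.
\<close>

lemma deficiency_Un_le:
  assumes "S \<subseteq> carrier G" "I \<inter> J = {}" "deficiency G I S \<le> n" "deficiency G J S \<le> n"
  shows "deficiency G (I \<union> J) S \<le> n"
  using assms
proof (induction n arbitrary: S)
  case 0
  then have "fills G I S" "fills G J S"
    using deficiency_eq_0 by auto
  then have "fills G (I \<union> J) S"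
    unfolding fills_def by blast
  then show ?case
    using deficiency_eq_0 0 by simp
next
  case (Suc n)
  have one: "\<exists>x\<in>carrier G. deficiency G I' (insert x S) \<le> n \<and>
      (\<forall>M. maximal_subgroup G M \<and> subgroup_index G M \<in> J' \<longrightarrow> x \<in> M)"
    if "I' \<inter> J' = {}" "deficiency G I' S \<le> Suc n" for I' J'
  proof (cases "deficiency G I' S = 0")
    case True
    have "deficiency G I' (insert \<one> S) \<le> deficiency G I' S"
      using Suc.prems by (intro deficiency_mono) auto
    moreover have "\<forall>M. maximal_subgroup G M \<and> subgroup_index G M \<in> J' \<longrightarrow> \<one> \<in> M"
      unfolding maximal_subgroup_def using subgroup.one_closed by blast
    ultimately show ?thesis
      using True by (intro bexI[of _ \<one>]) auto
  next
    case False
    then show ?thesis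
      using deficiency_decrease[OF Suc.prems(1) that(1)] that(2)
      by (metis less_Suc_eq_le neq0_conv order_less_le_trans)
  qed
  obtain x where x: "x \<in> carrier G" "deficiency G I (insert x S) \<le> n"
    "\<And>M. maximal_subgroup G M \<Longrightarrow> subgroup_index G M \<in> J \<Longrightarrow> x \<in> M"
    using one[OF Suc.prems(2,3)] by blast
  have JI: "J \<inter> I = {}"
    using Suc.prems(2) by blast
  obtain y where y: "y \<in> carrier G" "deficiency G J (insert y S) \<le> n"
    "\<And>M. maximal_subgroup G M \<Longrightarrow> subgroup_index G M \<in> I \<Longrightarrow> y \<in> M"
    using one[OF JI Suc.prems(4)] by blast
  have "fills G I (insert (x \<otimes> y) S \<union> T) \<longleftrightarrow> fills G I (insert x S \<union> T)" for T
    unfolding fills_def using subgroup_mult_right_mem_iff[OF _ y(3) x(1)] by (auto simp: maximal_subgroup_def)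
  moreover have "fills G J (insert (x \<otimes> y) S \<union> T) \<longleftrightarrow> fills G J (insert y S \<union> T)" for T
    unfolding fills_def using subgroup_mult_left_mem_iff[OF _ x(3) y(1)] by (auto simp: maximal_subgroup_def)
  ultimately have "deficiency G I (insert (x \<otimes> y) S) \<le> n" "deficiency G J (insert (x \<otimes> y) S) \<le> n"
    using x(2) y(2) unfolding deficiency_def by simp_all
  then have "deficiency G (I \<union> J) (insert (x \<otimes> y) S) \<le> n"
    using Suc x y by simp
  then show ?case
    using deficiency_insert[of S "x \<otimes> y" "I \<union> J"] Suc.prems x y by simp
qed

end

section \<open>The end of the game is a full maximal subgroup\<close>

text \<open>
  The player to move when \<open>n\<close> elements have been selected.
\<close>

definition turn :: "nat \<Rightarrow> player" where
  "turn n = (next_player ^^ n) Player1"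

text \<open>
  The player who wins if exactly \<open>n\<close> elements are selected before the losing move: the player who
  made the \<open>n\<close>-th selection.
\<close>

definition winner_at :: "nat \<Rightarrow> player" where
  "winner_at n = prev_player (turn n)"

lemma turn_Suc: "turn (Suc n) = next_player (turn n)"
  by (simp add: turn_def)

lemma prev_next [simp]: "prev_player (next_player i) = i"
  by (cases i) simp_all

lemma turn_mod: "turn n = (if n mod 3 = 0 then Player1 else if n mod 3 = 1 then Player2 else Player3)"
proof (induction n)
  case (Suc n)
  have "n mod 3 = 0 \<or> n mod 3 = 1 \<or> n mod 3 = 2"
    by presburger
  then show ?case
    unfolding turn_Suc Suc by (auto simp: mod_Suc)
qed (simp add: turn_def)

lemma winner_at_mod:
  "winner_at n = (if n mod 3 = 0 then Player3 else if n mod 3 = 1 then Player1 else Player2)"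
  by (simp add: winner_at_def turn_mod)

lemma place_le_3: "place w i \<le> 3"
  by (simp add: place_def)

lemma place_prev: "place (prev_player i) i = 3"
  by (cases i) (simp_all add: place_def)

lemma outcome_best_move:
  assumes "avoidance_outcome G i S w" "generate G S \<noteq> carrier G"
  obtains x where "x \<in> carrier G - S" "avoidance_outcome G (next_player i) (insert x S) w"
    "\<And>y. y \<in> carrier G - S \<Longrightarrow>
      \<exists>v. avoidance_outcome G (next_player i) (insert y S) v \<and> place w i \<le> place v i"
  using assms(1)
proof cases
  case finished
  with assms(2) show ?thesis by simp
next
  case (move x)
  then show ?thesis using that by blast
qed

context finite_nilpotent_group
begin

lemma card_insert_position:
  "S \<subseteq> carrier G \<Longrightarrow> x \<in> carrier G - S \<Longrightarrow> card (insert x S) = Suc (card S)"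
  using finite finite_subset by (metis DiffE card_insert_disjoint)

lemma losing_move_outcome:
  assumes "S \<subseteq> carrier G" "x \<in> carrier G - S" "generate G (insert x S) = carrier G"
    and "avoidance_outcome G (next_player i) (insert x S) w"
  shows "w = prev_player i"
  using avoidance_outcome_unique[OF assms(4) avoidance_outcome.finished[OF assms(3)]] by simp

text \<open>
  A set from which every selection generates the group contains every maximal subgroup above it,
  because an unselected element of such a subgroup would be a safe selection.
\<close>

lemma safe_move_or_maximal:
  assumes S: "S \<subseteq> carrier G" and proper: "generate G S \<noteq> carrier G"
  shows "maximal_subgroup G S \<or> (\<exists>x\<in>carrier G - S. generate G (insert x S) \<noteq> carrier G)"
proof (rule disjCI)
  assume unsafe: "\<not> (\<exists>x\<in>carrier G - S. generate G (insert x S) \<noteq> carrier G)"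
  obtain M where M: "maximal_subgroup G M" "S \<subseteq> M"
    using proper generate_proper_iff[OF finite S] by blast
  have "M \<subseteq> S"
  proof (rule ccontr)
    assume "\<not> M \<subseteq> S"
    then obtain x where x: "x \<in> M" "x \<notin> S"
      by blast
    then have "x \<in> carrier G"
      using M(1) subgroup.subset unfolding maximal_subgroup_def by blast
    moreover from this have "generate G (insert x S) \<noteq> carrier G"
      using generate_proper_iff[OF finite, of "insert x S"] S M x by blast
    ultimately show False
      using unsafe x by blast
  qed
  then show "maximal_subgroup G S"
    using M by auto
qed

text \<open>
  Once the selected elements form a maximal subgroup, every selection ends the game, so the order of
  that subgroup alone determines the winner.
\<close>

lemma maximal_subgroup_outcome:
  assumes "maximal_subgroup G S"
  shows "avoidance_outcome G (turn (card S)) S (winner_at (card S))"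
proof -
  let ?i = "turn (card S)"
  have sub: "subgroup S G" "S \<noteq> carrier G"
    using assms unfolding maximal_subgroup_def by auto
  have S: "S \<subseteq> carrier G"
    using subgroup.subset[OF sub(1)] .
  have "generate G S \<noteq> carrier G"
    using generate_proper_iff[OF finite S] assms by blast
  moreover obtain x where "x \<in> carrier G - S"
    using S sub(2) by blast
  moreover have "avoidance_outcome G (next_player ?i) (insert y S) (winner_at (card S))"
    if y: "y \<in> carrier G - S" for y
  proof -
    have "\<not> (\<exists>M. maximal_subgroup G M \<and> insert y S \<subseteq> M)"
    proof (intro notI, elim exE conjE)
      fix M assume M: "maximal_subgroup G M" "insert y S \<subseteq> M"
      then have "M = S"
        using assms unfolding maximal_subgroup_def by (metis insert_subset)
      then show False
        using M(2) y by blast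
    qed
    then have "generate G (insert y S) = carrier G"
      using generate_proper_iff[OF finite, of "insert y S"] S y by (metis DiffD1 insert_subset)
    from avoidance_outcome.finished[OF this, of "next_player ?i"] show ?thesis
      by (simp add: winner_at_def)
  qed
  ultimately show ?thesis
    by (intro avoidance_outcome.move[of G S x]) auto
qed

text \<open>
  The outcome is attached to some maximal subgroup above the position. The only delicate case is a
  player whose best move is to end the game at once. Losing is the worst place, so she could as well
  have made a safe move: the outcome of that move is no better for her, and since a place determines
  the winner, it is the same outcome.
\<close>

lemma outcome_from_maximal:
  assumes "S \<subseteq> carrier G" "generate G S \<noteq> carrier G" "avoidance_outcome G (turn (card S)) S w"
  shows "\<exists>M. maximal_subgroup G M \<and> S \<subseteq> M \<and> w = winner_at (card M)"
  using assms
proof (induction "card (carrier G - S)" arbitrary: S w rule: less_induct)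
  case less
  let ?i = "turn (card S)"
  consider "maximal_subgroup G S" | y where "y \<in> carrier G - S" "generate G (insert y S) \<noteq> carrier G"
    using safe_move_or_maximal[OF less.prems(1,2)] by blast
  then show ?case
  proof cases
    case 1
    then show ?thesis
      using avoidance_outcome_unique[OF less.prems(3) maximal_subgroup_outcome] by blast
  next
    case (2 y)
    obtain x where x: "x \<in> carrier G - S"
      "avoidance_outcome G (next_player ?i) (insert x S) w"
      "\<And>y. y \<in> carrier G - S \<Longrightarrow> \<exists>v. avoidance_outcome G (next_player ?i) (insert y S) v \<and>
        place w ?i \<le> place v ?i"
      using outcome_best_move[OF less.prems(3,2)] by blast
    have IH: "\<exists>M. maximal_subgroup G M \<and> insert z S \<subseteq> M \<and> w = winner_at (card M)"
      if z: "z \<in> carrier G - S" "generate G (insert z S) \<noteq> carrier G"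
        "avoidance_outcome G (next_player ?i) (insert z S) w" for z
    proof (rule less.hyps)
      show "card (carrier G - insert z S) < card (carrier G - S)"
        using z finite by (intro psubset_card_mono) auto
      show "avoidance_outcome G (turn (card (insert z S))) (insert z S) w"
        using z(3) card_insert_position[OF less.prems(1) z(1)] by (simp add: turn_Suc)
    qed (use z less.prems(1) in auto)
    show ?thesis
    proof (cases "generate G (insert x S) = carrier G")
      case False
      then show ?thesis
        using IH[OF x(1) _ x(2)] by blast
    next
      case True
      have w: "w = prev_player ?i"
        by (rule losing_move_outcome[OF less.prems(1) x(1) True x(2)])
      obtain v where v: "avoidance_outcome G (next_player ?i) (insert y S) v"
        "place w ?i \<le> place v ?i"
        using x(3)[OF 2(1)] by blast
      have "place w ?i = place v ?i"
        using v(2) place_le_3[of v ?i] unfolding w place_prev by simp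
      then have "w = v"
        by (metis place_inject)
      then show ?thesis
        using IH[OF 2(1,2)] v(1) by blast
    qed
  qed
qed

section \<open>The race between two coalitions\<close>

text \<open>
  Suppose that ending in a maximal subgroup of index in \<open>I\<close> makes \<open>v\<close> the winner and ending in one of
  index in \<open>J\<close> makes \<open>w\<close> the winner. The players split into a team, who prefer \<open>w\<close>, and opponents, who
  prefer \<open>v\<close>. The team reaches its goal as soon as \<open>I\<close> is filled while the group is not generated,
  since then only maximal subgroups of index in \<open>J\<close> remain. So the game is a race between filling
  \<open>I\<close> and filling \<open>J\<close>, in which a member of the team can always lower the deficiency of \<open>I\<close> by one
  without touching that of \<open>J\<close>, and in which no move lowers a deficiency by more than one.
  
  The predicate \<open>R n a b\<close> expresses that the team is ahead after \<open>n\<close> selections, with deficiencies \<open>a\<close>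
  and \<open>b\<close> of \<open>I\<close> and \<open>J\<close>. The hypotheses on \<open>R\<close> say that the team keeps the lead if it spends its moves
  in this way, even if every move of an opponent lowers \<open>b\<close> by one.
\<close>

lemma race:
  fixes R :: "nat \<Rightarrow> nat \<Rightarrow> nat \<Rightarrow> bool"
  assumes nontrivial: "generate G {} \<noteq> carrier G"
    and disj: "I \<inter> J = {}"
    and cover: "\<And>M. maximal_subgroup G M \<Longrightarrow> subgroup_index G M \<in> I \<union> J"
    and win_I: "\<And>M. maximal_subgroup G M \<Longrightarrow> subgroup_index G M \<in> I \<Longrightarrow> winner_at (card M) = v"
    and win_J: "\<And>M. maximal_subgroup G M \<Longrightarrow> subgroup_index G M \<in> J \<Longrightarrow> winner_at (card M) = w"
    and mono: "\<And>n a b a' b'. R n a b \<Longrightarrow> a' \<le> a \<Longrightarrow> b \<le> b' \<Longrightarrow> R n a' b'"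
    and team: "\<And>n a b. place w (turn n) \<le> place v (turn n) \<Longrightarrow> R n (Suc a) b \<Longrightarrow>
      a = 0 \<or> R (Suc n) a b"
    and opponent: "\<And>n a b. place v (turn n) < place w (turn n) \<Longrightarrow> R n (Suc a) (Suc b) \<Longrightarrow>
      0 < b \<and> R (Suc n) (Suc a) b"
    and start: "deficiency G I {} = 0 \<or>
      0 < deficiency G J {} \<and> R 0 (deficiency G I {}) (deficiency G J {})"
  shows "has_winning_strategy G w"
proof -
  define good where "good S \<longleftrightarrow> deficiency G I S = 0 \<or>
      0 < deficiency G J S \<and> R (card S) (deficiency G I S) (deficiency G J S)" for S
  have "avoidance_outcome G (turn (card S)) S w"
    if "S \<subseteq> carrier G" "generate G S \<noteq> carrier G" "good S" for S
    using that
  proof (induction "card (carrier G - S)" arbitrary: S rule: less_induct)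
    case less
    note S = less.prems(1) and proper = less.prems(2) and good = less.prems(3)
    let ?i = "turn (card S)"
    have IH: "avoidance_outcome G (next_player ?i) (insert z S) w"
      if z: "z \<in> carrier G - S" "generate G (insert z S) \<noteq> carrier G" "good (insert z S)" for z
    proof -
      have "avoidance_outcome G (turn (card (insert z S))) (insert z S) w"
      proof (rule less.hyps)
        show "card (carrier G - insert z S) < card (carrier G - S)"
          using z finite by (intro psubset_card_mono) auto
      qed (use z S in auto)
      then show ?thesis
        using card_insert_position[OF S z(1)] by (simp add: turn_Suc)
    qed
    have move: ?case
      if x: "x \<in> carrier G - S" "generate G (insert x S) \<noteq> carrier G" "good (insert x S)"
        and others: "\<And>y. y \<in> carrier G - S \<Longrightarrow> generate G (insert y S) \<noteq> carrier G \<Longrightarrow>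
          place w ?i \<le> place v ?i \<or> good (insert y S)" for x
    proof (rule avoidance_outcome.move[OF proper x(1) IH[OF x]], intro ballI)
      fix y assume y: "y \<in> carrier G - S"
      have subset: "insert y S \<subseteq> carrier G"
        using S y by blast
      obtain u where u: "avoidance_outcome G (next_player ?i) (insert y S) u"
        using avoidance_outcome_exists[OF finite subset] by blast
      have "place w ?i \<le> place u ?i"
      proof (cases "generate G (insert y S) = carrier G")
        case True
        then show ?thesis
          using losing_move_outcome[OF S y True u] place_prev place_le_3 by simp
      next
        case False
        show ?thesis
        proof (cases "good (insert y S)")
          case True
          then have "u = w"
            using avoidance_outcome_unique[OF u IH[OF y False]] by blast
          then show ?thesis by simp
        next
          case bad: False
          have "avoidance_outcome G (turn (card (insert y S))) (insert y S) u"
            using u card_insert_position[OF S y] by (simp add: turn_Suc)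
          then obtain M where "maximal_subgroup G M" "u = winner_at (card M)"
            using outcome_from_maximal[OF subset False] by blast
          then have "u = v \<or> u = w"
            using cover win_I win_J by blast
          then show ?thesis
            using others[OF y False] bad by auto
        qed
      qed
      then show "\<exists>u. avoidance_outcome G (next_player ?i) (insert y S) u \<and> place w ?i \<le> place u ?i"
        using u by blast
    qed
    show ?case
    proof (cases "maximal_subgroup G S")
      case max: True
      have "subgroup_index G S \<in> J"
      proof (cases "fills G I S")
        case True
        then show ?thesis
          using max cover unfolding fills_def by blast
      next
        case False
        then have "\<not> fills G J S"
          using good deficiency_eq_0[OF S] unfolding good_def by (metis less_numeral_extra(3))
        then obtain M where M: "maximal_subgroup G M" "S \<subseteq> M" "subgroup_index G M \<in> J"
          unfolding fills_def by blast
        then have "M = S"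
          using max unfolding maximal_subgroup_def by blast
        then show ?thesis
          using M by simp
      qed
      then show ?thesis
        using maximal_subgroup_outcome[OF max] win_J[OF max] by simp
    next
      case False
      then obtain z where z: "z \<in> carrier G - S" "generate G (insert z S) \<noteq> carrier G"
        using safe_move_or_maximal[OF S proper] by blast
      show ?thesis
      proof (cases "deficiency G I S = 0")
        case True
        then have good: "good (insert y S)" if "y \<in> carrier G - S" for y
          using deficiency_mono[OF subset_insertI, of y S I I] S that unfolding good_def by simp
        show ?thesis
          by (rule move[OF z good[OF z(1)]]) (use good in blast)
      next
        case pos: False
        then obtain a where a: "deficiency G I S = Suc a"
          using not0_implies_Suc by blast
        obtain b where b: "deficiency G J S = Suc b" "R (card S) (Suc a) (Suc b)"
          using good pos a unfolding good_def by (metis gr0_implies_Suc)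
        show ?thesis
        proof (cases "place w ?i \<le> place v ?i")
          case True
          obtain x where x: "x \<in> carrier G" "deficiency G I (insert x S) < deficiency G I S"
            "\<And>M. maximal_subgroup G M \<Longrightarrow> subgroup_index G M \<in> J \<Longrightarrow> x \<in> M"
            using deficiency_decrease[OF S disj] pos by blast
          have J: "deficiency G J (insert x S) = Suc b"
            using deficiency_insert_neutral[OF x(3)] b(1) by simp
          have xS: "x \<in> carrier G - S"
            using x(1,2) by (auto simp: insert_absorb)
          have "\<not> fills G J (insert x S)"
            using J deficiency_eq_0[of "insert x S" J] S x(1) by simp
          then have "generate G (insert x S) \<noteq> carrier G"
            using generate_proper_iff[OF finite, of "insert x S"] S x(1) unfolding fills_def by blast
          moreover have "good (insert x S)"
          proof -
            have "deficiency G I (insert x S) \<le> a"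
              using x(2) a by simp
            moreover have "a = 0 \<or> R (Suc (card S)) a (Suc b)"
              using team[OF True b(2)] .
            ultimately show ?thesis
              using mono J card_insert_position[OF S xS] unfolding good_def by auto
          qed
          ultimately show ?thesis
            using move xS True by blast
        next
          case False
          have next_R: "0 < b" "R (Suc (card S)) (Suc a) b"
            using opponent[OF _ b(2)] False by auto
          have good: "good (insert y S)" if y: "y \<in> carrier G - S" for y
          proof -
            have "deficiency G I (insert y S) \<le> Suc a"
              using deficiency_mono[of S "insert y S" I I] a S y by auto
            moreover have "b \<le> deficiency G J (insert y S)"
              using deficiency_insert[of S y J] b(1) S y by auto
            ultimately show ?thesis
              using next_R mono[OF next_R(2)] card_insert_position[OF S y] unfolding good_def by auto
          qed
          show ?thesis
            by (rule move[OF z good[OF z(1)]]) (use good in blast)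
        qed
      qed
    qed
  qed
  from this[of "{}"] show ?thesis
    using nontrivial start by (simp add: good_def has_winning_strategy_def turn_def)
qed

end

section \<open>Generators of a product of Sylow subgroups\<close>

text \<open>
  The product over a list instead of a finite set gives a product in a possibly noncommutative group
  a definite order of factors; the order is immaterial for the commuting families considered here.
\<close>

definition list_prod :: "('a, 'b) monoid_scheme \<Rightarrow> ('i \<Rightarrow> 'a) \<Rightarrow> 'i list \<Rightarrow> 'a" where
  "list_prod G f ps = foldr (\<lambda>p y. f p \<otimes>\<^bsub>G\<^esub> y) ps \<one>\<^bsub>G\<^esub>"

lemma list_prod_Nil [simp]: "list_prod G f [] = \<one>\<^bsub>G\<^esub>"
  and list_prod_Cons [simp]: "list_prod G f (p # ps) = f p \<otimes>\<^bsub>G\<^esub> list_prod G f ps"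
  by (simp_all add: list_prod_def)

lemma list_prod_cong:
  "(\<And>p. p \<in> set ps \<Longrightarrow> f p = g p) \<Longrightarrow> list_prod G f ps = list_prod G g ps"
  by (induction ps) simp_all

context group
begin

lemma list_prod_closed [simp]:
  "(\<And>p. p \<in> set ps \<Longrightarrow> f p \<in> carrier G) \<Longrightarrow> list_prod G f ps \<in> carrier G"
  by (induction ps) simp_all

lemma list_prod_commute:
  assumes "x \<in> carrier G" "\<And>p. p \<in> set ps \<Longrightarrow> f p \<in> carrier G"
    "\<And>p. p \<in> set ps \<Longrightarrow> x \<otimes> f p = f p \<otimes> x"
  shows "x \<otimes> list_prod G f ps = list_prod G f ps \<otimes> x"
  using assms(2,3)
proof (induction ps)
  case (Cons p ps)
  have closed: "f p \<in> carrier G" "list_prod G f ps \<in> carrier G"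
    using Cons.prems by auto
  have "x \<otimes> (f p \<otimes> list_prod G f ps) = (x \<otimes> f p) \<otimes> list_prod G f ps"
    using closed assms(1) by (simp add: m_assoc)
  also have "\<dots> = f p \<otimes> (x \<otimes> list_prod G f ps)"
    using closed assms(1) Cons.prems(2)[of p] by (simp add: m_assoc)
  finally show ?case
    using Cons assms(1) by (simp add: m_assoc)
qed (use assms in simp)

lemma list_prod_mult:
  assumes "distinct ps"
    and "\<And>p. p \<in> set ps \<Longrightarrow> f p \<in> carrier G" "\<And>p. p \<in> set ps \<Longrightarrow> g p \<in> carrier G"
    and "\<And>p q. p \<in> set ps \<Longrightarrow> q \<in> set ps \<Longrightarrow> p \<noteq> q \<Longrightarrow> f p \<otimes> g q = g q \<otimes> f p"
  shows "list_prod G (\<lambda>p. f p \<otimes> g p) ps = list_prod G f ps \<otimes> list_prod G g ps"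
  using assms
proof (induction ps)
  case (Cons p ps)
  have closed: "f p \<in> carrier G" "g p \<in> carrier G"
    "list_prod G f ps \<in> carrier G" "list_prod G g ps \<in> carrier G"
    using Cons.prems by auto
  have comm: "g p \<otimes> list_prod G f ps = list_prod G f ps \<otimes> g p"
    using Cons.prems by (intro list_prod_commute) (auto simp: eq_commute)
  have "(f p \<otimes> g p) \<otimes> (list_prod G f ps \<otimes> list_prod G g ps)
      = f p \<otimes> (g p \<otimes> list_prod G f ps) \<otimes> list_prod G g ps"
    using closed by (simp add: m_assoc)
  also have "\<dots> = (f p \<otimes> list_prod G f ps) \<otimes> (g p \<otimes> list_prod G g ps)"
    unfolding comm using closed by (simp add: m_assoc)
  finally show ?case
    using Cons by simp
qed simp

lemma list_prod_pow:
  assumes "distinct ps" and closed: "\<And>p. p \<in> set ps \<Longrightarrow> f p \<in> carrier G"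
    and comm: "\<And>p q. p \<in> set ps \<Longrightarrow> q \<in> set ps \<Longrightarrow> p \<noteq> q \<Longrightarrow> f p \<otimes> f q = f q \<otimes> f p"
  shows "list_prod G f ps [^] (k::nat) = list_prod G (\<lambda>p. f p [^] k) ps"
proof (induction k)
  case 0
  have "list_prod G (\<lambda>p. \<one>) ps = \<one>"
    by (induction ps) simp_all
  then show ?case
    by simp
next
  case (Suc k)
  have "list_prod G (\<lambda>p. f p [^] k \<otimes> f p) ps = list_prod G (\<lambda>p. f p [^] k) ps \<otimes> list_prod G f ps"
    using assms by (intro list_prod_mult) (auto simp: group_commutes_pow)
  then show ?case
    using Suc by simp
qed

lemma list_prod_single:
  assumes "distinct ps" "q \<in> set ps" "f q \<in> carrier G"
    "\<And>p. p \<in> set ps \<Longrightarrow> p \<noteq> q \<Longrightarrow> f p = \<one>"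
  shows "list_prod G f ps = f q"
  using assms
proof (induction ps)
  case (Cons p ps)
  show ?case
  proof (cases "p = q")
    case True
    then have "list_prod G f ps = list_prod G (\<lambda>_. \<one>) ps"
      using Cons.prems by (intro list_prod_cong) auto
    also have "\<dots> = \<one>"
      by (induction ps) simp_all
    finally show ?thesis
      using True Cons.prems by simp
  next
    case False
    then show ?thesis
      using Cons by simp
  qed
qed simp

lemma subgroup_pow_card:
  assumes S: "subgroup S G" and fin: "finite S" and x: "x \<in> S"
  shows "x [^] card S = \<one>"
proof -
  interpret S: group "G\<lparr>carrier := S\<rparr>"
    by (rule subgroup_imp_group[OF S])
  have "x [^]\<^bsub>G\<lparr>carrier := S\<rparr>\<^esub> order (G\<lparr>carrier := S\<rparr>) = \<one>"
    using S.pow_order_eq_1[of x] x by simp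
  then show ?thesis
    by (simp add: order_def flip: nat_pow_consistent)
qed

end

lemma (in group) obtain_min_gens:
  assumes "finite (carrier G)"
  obtains S where "S \<subseteq> carrier G" "finite S" "card S = min_gens G" "generate G S = carrier G"
proof -
  have "generate G (carrier G) = carrier G"
    using generate_incl generate.incl by fast
  then have "\<exists>n S. S \<subseteq> carrier G \<and> finite S \<and> card S = n \<and> generate G S = carrier G"
    using assms by blast
  from LeastI_ex[OF this] show thesis
    unfolding min_gens_def[symmetric] using that by blast
qed

lemma (in group) min_gens_le:
  "S \<subseteq> carrier G \<Longrightarrow> finite S \<Longrightarrow> generate G S = carrier G \<Longrightarrow> min_gens G \<le> card S"
  unfolding min_gens_def by (intro Least_le) blast

lemma (in group_hom) subgroup_preimage:
  assumes "subgroup N H"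
  shows "subgroup {x \<in> carrier G. h x \<in> N} G"
  using assms by unfold_locales (auto simp: subgroup.m_closed subgroup.one_closed subgroup.m_inv_closed)

text \<open>
  If the kernel of a surjective homomorphism \<open>h\<close> only concerns primes outside \<open>J\<close>, and the order of
  the image only primes in \<open>J\<close>, then the maximal subgroups of index in \<open>J\<close> are exactly those that
  contain the kernel, that is, the preimages of the maximal subgroups of the image. Hence a set fills
  \<open>J\<close> exactly if its image generates \<open>H\<close>.
\<close>

lemma (in finite_nilpotent_group) min_gens_quotient:
  assumes H: "group H" and fin: "finite (carrier H)"
    and hom: "h \<in> hom G H" and surj: "h ` carrier G = carrier H"
    and ker: "\<And>p x. Factorial_Ring.prime p \<Longrightarrow> p \<in> J \<Longrightarrow> x \<in> carrier G \<Longrightarrow> h x = \<one>\<^bsub>H\<^esub> \<Longrightarrow>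
      \<exists>c. coprime c p \<and> x [^] c = \<one>"
    and ord: "\<And>p. Factorial_Ring.prime p \<Longrightarrow> p dvd order G \<Longrightarrow> p \<notin> J \<Longrightarrow> coprime (order H) p"
  shows "deficiency G J {} = min_gens H"
proof (rule antisym)
  interpret H: group H by (rule H)
  interpret h: group_hom G H h
    using hom by unfold_locales
  obtain U where U: "U \<subseteq> carrier H" "finite U" "card U = min_gens H" "generate H U = carrier H"
    using H.obtain_min_gens[OF fin] by blast
  obtain T where T: "T \<subseteq> carrier G" "inj_on h T" "h ` T = U"
    using U(1) surj by (metis subset_image_inj)
  have "fills G J T"
    unfolding fills_def
  proof (intro allI impI notI, elim conjE)
    fix M assume M: "maximal_subgroup G M" "T \<subseteq> M" "subgroup_index G M \<in> J"
    obtain p where p: "Factorial_Ring.prime p" "subgroup_index G M = p"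
      "\<And>x. x \<in> carrier G \<Longrightarrow> x [^] p \<in> M"
      using nilpotent_maximal_index[OF finite nilpotent M(1)] by metis
    have sub: "subgroup M G" "M \<noteq> carrier G"
      using M(1) unfolding maximal_subgroup_def by auto
    have ker_M: "x \<in> M" if x: "x \<in> carrier G" "h x = \<one>\<^bsub>H\<^esub>" for x
    proof -
      obtain c where "coprime c p" "x [^] c = \<one>"
        using ker[OF p(1) _ x] M(3) p(2) by blast
      then show ?thesis
        using coprime_pow_mem[OF sub(1) x(1), of c p] p(3) x(1) subgroup.one_closed[OF sub(1)] by simp
    qed
    have "subgroup (h ` M) H"
      using h.subgroup_img_is_subgroup[OF sub(1)] .
    then have "generate H U \<subseteq> h ` M"
      using H.generate_subgroup_incl[of U "h ` M"] T(3) M(2) by blast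
    then have all: "carrier H \<subseteq> h ` M"
      using U(4) by simp
    have "x \<in> M" if x: "x \<in> carrier G" for x
    proof -
      have "h x \<in> h ` M"
        using all x by auto
      then obtain m where m: "m \<in> M" "h x = h m"
        by blast
      then have mG: "m \<in> carrier G"
        using subgroup.mem_carrier[OF sub(1)] by blast
      have "x \<otimes> inv m \<in> M"
        using m x mG by (intro ker_M) auto
      then show ?thesis
        using subgroup_mult_right_mem_iff[OF sub(1) subgroup.m_inv_closed[OF sub(1) m(1)] x] by simp
    qed
    then show False
      using sub(2) subgroup.subset[OF sub(1)] by blast
  qed
  moreover have "finite T" "card T = card U"
    using T U finite_image_iff card_image by (metis, metis)
  ultimately show "deficiency G J {} \<le> min_gens H"
    using deficiency_le[OF T(1), of J "{}"] U(3) by simp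
next
  interpret H: group H by (rule H)
  interpret h: group_hom G H h
    using hom by unfold_locales
  obtain T where T: "T \<subseteq> carrier G" "finite T" "card T = deficiency G J {}" "fills G J ({} \<union> T)"
    using deficiency_witness[of "{}" J] by blast
  let ?L = "generate H (h ` T)"
  have hT: "h ` T \<subseteq> carrier H"
    using T(1) by auto
  have L: "subgroup ?L H"
    by (rule H.generate_is_subgroup[OF hT])
  have "?L = carrier H"
  proof (rule ccontr)
    assume proper: "?L \<noteq> carrier H"
    let ?N = "{x \<in> carrier G. h x \<in> ?L}"
    have "?N \<noteq> carrier G"
    proof
      assume "?N = carrier G"
      then have "carrier H \<subseteq> ?L"
        unfolding surj[symmetric] by blast
      then show False
        using proper subgroup.subset[OF L] by blast
    qed
    then obtain M where M: "maximal_subgroup G M" "?N \<subseteq> M"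
      using proper_subgroup_le_maximal[OF finite h.subgroup_preimage[OF L]] by blast
    obtain p where p: "Factorial_Ring.prime p" "subgroup_index G M = p" "order G = p * card M"
      "\<And>x. x \<in> carrier G \<Longrightarrow> x [^] p \<in> M"
      using nilpotent_maximal_index[OF finite nilpotent M(1)] by metis
    have "T \<subseteq> M"
      using M(2) T(1) generate.incl[of _ "h ` T" H] by blast
    then have "p \<notin> J"
      using T(4) M(1) p(2) unfolding fills_def by auto
    then have cop: "coprime (order H) p"
      using ord p(1,3) by simp
    have sub: "subgroup M G" "M \<noteq> carrier G"
      using M(1) unfolding maximal_subgroup_def by auto
    have "x \<in> M" if x: "x \<in> carrier G" for x
    proof (rule coprime_pow_mem[OF sub(1) x _ p(4)[OF x] cop])
      have "h (x [^] order H) = \<one>\<^bsub>H\<^esub>"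
        using x H.pow_order_eq_1[of "h x"] by (simp add: h.hom_nat_pow)
      then have "x [^] order H \<in> ?N"
        using x by (simp add: generate.one)
      then show "x [^] order H \<in> M"
        using M(2) by blast
    qed
    then show False
      using sub subgroup.subset by blast
  qed
  then have "min_gens H \<le> card (h ` T)"
    using hT T(2) by (intro H.min_gens_le) auto
  also have "\<dots> \<le> card T"
    by (rule card_image_le[OF T(2)])
  finally show "min_gens H \<le> deficiency G J {}"
    using T(3) by simp
qed

text \<open>
  Multiplying out is a homomorphism because elements of different factors commute. It is injective:
  raising a trivial product to the power \<open>m\<close>, the product of the orders of all factors other than the
  \<open>q\<close>-th, leaves only the \<open>q\<close>-th component to the power \<open>m\<close>, and \<open>m\<close> is prime to the order of that
  component. It is bijective since both
  groups have the same order.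
\<close>

lemma (in finite_nilpotent_group) sylow_product_iso:
  fixes P :: "nat \<Rightarrow> 'a set"
  defines "D \<equiv> {p. Factorial_Ring.prime p \<and> p dvd order G}"
  assumes P: "\<And>p. p \<in> D \<Longrightarrow> sylow_subgroup G p (P p)"
  shows "(\<lambda>f. list_prod G f (sorted_list_of_set D)) \<in> iso (product_group D (\<lambda>p. G\<lparr>carrier := P p\<rparr>)) G"
    (is "?F \<in> iso ?Q G")
proof -
  let ?ps = "sorted_list_of_set D"
  have ord: "order G > 0"
    using finite order_gt_0_iff_finite by simp
  have D: "D = prime_factors (order G)"
    using ord by (auto simp: D_def in_prime_factors_iff)
  then have finD: "finite D"
    by simp
  then have ps: "set ?ps = D" "distinct ?ps"
    by simp_all
  have sub: "subgroup (P p) G" "card (P p) = p ^ multiplicity p (order G)" if "p \<in> D" for p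
    using P[OF that] unfolding sylow_subgroup_def by auto
  have finP: "finite (P p)" if "p \<in> D" for p
    using sub(1)[OF that] finite subgroup.subset finite_subset by blast
  have PG: "x \<in> carrier G" if "p \<in> D" "x \<in> P p" for p x
    using subgroup.mem_carrier[OF sub(1)[OF that(1)] that(2)] .
  have pow1: "x [^] card (P p) = \<one>" if "p \<in> D" "x \<in> P p" for p x
    using subgroup_pow_card[OF sub(1) finP] that by blast
  have cop: "coprime (card (P p)) (card (P q))" if "p \<in> D" "q \<in> D" "p \<noteq> q" for p q
    using that sub(2) primes_coprime unfolding D_def by auto
  have comm: "x \<otimes> y = y \<otimes> x" if "p \<in> D" "q \<in> D" "p \<noteq> q" "x \<in> P p" "y \<in> P q" for p q x y
    using that nilpotent_coprime_commute[OF nilpotent PG pow1 PG pow1 cop] by blast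
  have grp: "group (G\<lparr>carrier := P p\<rparr>)" if "p \<in> D" for p
    using subgroup_imp_group[OF sub(1)[OF that]] .
  interpret Q: group ?Q
    using grp by simp
  have Qmem: "f p \<in> P p" if "f \<in> carrier ?Q" "p \<in> D" for f p
    using that by (auto simp: PiE_iff)
  have closed: "f p \<in> carrier G" if "f \<in> carrier ?Q" "p \<in> D" for f p
    using PG Qmem that by blast
  have hom: "?F \<in> hom ?Q G"
  proof (rule homI)
    fix f g assume f: "f \<in> carrier ?Q" and g: "g \<in> carrier ?Q"
    have "list_prod G (f \<otimes>\<^bsub>?Q\<^esub> g) ?ps = list_prod G (\<lambda>p. f p \<otimes> g p) ?ps"
      by (rule list_prod_cong) (simp add: ps)
    also have "\<dots> = ?F f \<otimes> ?F g"
      using closed[OF f] closed[OF g] comm Qmem[OF f] Qmem[OF g]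
      by (intro list_prod_mult) (simp_all add: ps)
    finally show "?F (f \<otimes>\<^bsub>?Q\<^esub> g) = ?F f \<otimes> ?F g" .
  next
    show "?F f \<in> carrier G" if "f \<in> carrier ?Q" for f
      by (intro list_prod_closed closed[OF that]) (simp add: ps)
  qed
  interpret F: group_hom ?Q G ?F
    using hom by unfold_locales
  have trivial: "f = \<one>\<^bsub>?Q\<^esub>" if f: "f \<in> carrier ?Q" "?F f = \<one>" for f
  proof -
    have "f q = \<one>" if q: "q \<in> D" for q
    proof -
      define m where "m = (\<Prod>p\<in>D - {q}. card (P p))"
      have "f p [^] m = \<one>" if p: "p \<in> D" "p \<noteq> q" for p
      proof -
        have "card (P p) dvd m"
          unfolding m_def using p finD by (intro dvd_prodI) auto
        then obtain k where "m = card (P p) * k"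
          by blast
        then show ?thesis
          using pow1[OF p(1) Qmem[OF f(1) p(1)]] closed[OF f(1) p(1)]
          by (simp flip: nat_pow_pow)
      qed
      then have "list_prod G (\<lambda>p. f p [^] m) ?ps = f q [^] m"
        using closed[OF f(1)] q ps by (intro list_prod_single) auto
      then have "f q [^] m = ?F f [^] m"
        using closed[OF f(1)] comm Qmem[OF f(1)] ps by (subst list_prod_pow) auto
      then have "f q [^] m = \<one>"
        using f(2) by simp
      moreover have "coprime (card (P q)) m"
        unfolding m_def using q cop by (intro prod_coprime_right) auto
      ultimately show ?thesis
        using pow_eq_one_coprime[OF closed[OF f(1) q] pow1[OF q Qmem[OF f(1) q]]] by blast
    qed
    then show ?thesis
      using f(1) by (intro extensionalityI[of _ D]) (auto simp: PiE_iff)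
  qed
  have inj: "inj_on ?F (carrier ?Q)"
    using trivial unfolding F.inj_on_one_iff by blast
  have "card (?F ` carrier ?Q) = card (carrier ?Q)"
    using inj by (rule card_image)
  also have "\<dots> = (\<Prod>p\<in>D. p ^ multiplicity p (order G))"
    using sub(2) finD by (simp add: card_PiE)
  also have "\<dots> = card (carrier G)"
    using prime_factorization_nat[OF ord] D by (simp add: order_def)
  finally have "?F ` carrier ?Q = carrier G"
    using finite F.hom_closed by (intro card_subset_eq) auto
  then show ?thesis
    using hom inj by (simp add: iso_def bij_betw_def)
qed

lemma (in group) nat_pow_product_group:
  assumes "p \<in> D"
  shows "(f [^]\<^bsub>product_group D (\<lambda>p. G\<lparr>carrier := P p\<rparr>)\<^esub> (k::nat)) p = f p [^] k"
  using assms by (induction k) simp_all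

text \<open>
  Inverting the isomorphism above and forgetting the coordinates outside \<open>J\<close> maps \<open>G\<close> onto the
  partial product; the kernel has exponent prime to \<open>J\<close>.
\<close>

lemma (in finite_nilpotent_group) min_gens_sylow_product:
  fixes P :: "nat \<Rightarrow> 'a set"
  defines "D \<equiv> {p. Factorial_Ring.prime p \<and> p dvd order G}"
  assumes P: "\<And>p. p \<in> D \<Longrightarrow> sylow_subgroup G p (P p)" and JD: "J \<subseteq> D"
  shows "min_gens (product_group J (\<lambda>p. G\<lparr>carrier := P p\<rparr>)) = deficiency G J {}"
    (is "min_gens ?H = _")
proof -
  let ?Q = "product_group D (\<lambda>p. G\<lparr>carrier := P p\<rparr>)"
  have ord: "order G > 0"
    using finite order_gt_0_iff_finite by simp
  have D: "D = prime_factors (order G)"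
    using ord by (auto simp: D_def in_prime_factors_iff)
  then have finD: "finite D"
    by simp
  have sub: "subgroup (P p) G" "card (P p) = p ^ multiplicity p (order G)" if "p \<in> D" for p
    using P[OF that] unfolding sylow_subgroup_def by auto
  have finP: "finite (P p)" if "p \<in> D" for p
    using sub(1)[OF that] finite subgroup.subset finite_subset by blast
  have cop: "coprime (card (P q)) p" if "q \<in> D" "Factorial_Ring.prime p" "q \<noteq> p" for p q
    using that sub(2) primes_coprime unfolding D_def by auto
  have grp: "group (G\<lparr>carrier := P p\<rparr>)" if "p \<in> D" for p
    using subgroup_imp_group[OF sub(1)[OF that]] .
  have H: "group ?H" and Q: "group ?Q"
    using grp JD by (auto intro!: product_group)
  obtain F where F: "F \<in> iso ?Q G"
    using sylow_product_iso[of P] P unfolding D_def by blast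
  obtain E where E: "E \<in> iso G ?Q"
    using group.iso_set_sym[OF Q F] by blast
  have Ehom: "E \<in> hom G ?Q" and Ebij: "bij_betw E (carrier G) (carrier ?Q)"
    using E unfolding iso_def by auto
  interpret E: group_hom G ?Q E
    by (rule group_hom.intro[OF is_group Q]) (use Ehom in \<open>simp add: group_hom_axioms_def\<close>)
  define r where "r f = restrict f J" for f :: "nat \<Rightarrow> 'a"
  have rhom: "r \<in> hom ?Q ?H"
    using JD by (intro homI) (auto simp: r_def PiE_iff fun_eq_iff)
  have rsurj: "r ` carrier ?Q = carrier ?H"
  proof
    show "r ` carrier ?Q \<subseteq> carrier ?H"
      using rhom by (auto simp: hom_def)
    show "carrier ?H \<subseteq> r ` carrier ?Q"
    proof
      fix f assume f: "f \<in> carrier ?H"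
      let ?g = "\<lambda>p\<in>D. if p \<in> J then f p else \<one>"
      have "?g \<in> carrier ?Q"
        using f sub(1) by (auto simp: PiE_iff subgroup.one_closed)
      moreover have "r ?g = f"
        using f JD by (auto simp: r_def PiE_iff extensional_def fun_eq_iff)
      ultimately show "f \<in> r ` carrier ?Q"
        by (intro image_eqI[of _ _ ?g]) simp_all
    qed
  qed
  have "deficiency G J {} = min_gens ?H"
  proof (rule min_gens_quotient[OF H])
    show "finite (carrier ?H)"
      using finD finP JD by (auto intro!: finite_PiE dest: finite_subset)
    show "(r \<circ> E) \<in> hom G ?H"
      by (rule Group.hom_compose[OF Ehom rhom])
    show "(r \<circ> E) ` carrier G = carrier ?H"
      using Ebij rsurj unfolding bij_betw_def image_comp[symmetric] by simp
  next
    fix p x assume p: "Factorial_Ring.prime p" "p \<in> J" and x: "x \<in> carrier G" "(r \<circ> E) x = \<one>\<^bsub>?H\<^esub>"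
    define c where "c = (\<Prod>q\<in>D - J. card (P q))"
    have Ex: "E x \<in> carrier ?Q"
      using x(1) by (rule E.hom_closed)
    have "(E x [^]\<^bsub>?Q\<^esub> c) q = \<one>" if q: "q \<in> D" for q
    proof (cases "q \<in> J")
      case True
      then have "E x q = \<one>"
        using x(2) by (auto simp: r_def fun_eq_iff dest!: spec[of _ q])
      then show ?thesis
        using nat_pow_product_group[OF q] by simp
    next
      case False
      then have "card (P q) dvd c"
        unfolding c_def using q finD by (intro dvd_prodI) auto
      moreover have mem: "E x q \<in> P q"
        using Ex q by (auto simp: PiE_iff)
      moreover have "E x q [^] card (P q) = \<one>"
        using subgroup_pow_card[OF sub(1)[OF q] finP[OF q] mem] .
      moreover have "E x q \<in> carrier G"
        using subgroup.mem_carrier[OF sub(1)[OF q] mem] .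
      ultimately show ?thesis
        using nat_pow_product_group[OF q] by (metis dvd_def nat_pow_one nat_pow_pow)
    qed
    moreover have "E x [^]\<^bsub>?Q\<^esub> c \<in> carrier ?Q"
      using Ex E.H.nat_pow_closed by blast
    ultimately have "E x [^]\<^bsub>?Q\<^esub> c = \<one>\<^bsub>?Q\<^esub>"
      by (intro extensionalityI[of _ D]) (auto simp: PiE_iff)
    then have "E (x [^] c) = E \<one>"
      using E.hom_nat_pow[OF x(1)] E.hom_one by simp
    then have "x [^] c = \<one>"
      by (rule inj_onD[OF bij_betw_imp_inj_on[OF Ebij]]) (use x(1) in simp_all)
    moreover have "coprime c p"
      unfolding c_def using p by (intro prod_coprime_left cop) auto
    ultimately show "\<exists>c. coprime c p \<and> x [^] c = \<one>"
      by blast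
  next
    fix p assume p: "Factorial_Ring.prime p" "p dvd order G" "p \<notin> J"
    have "order ?H = (\<Prod>q\<in>J. card (P q))"
      using finite_subset[OF JD finD] by (simp add: order_def card_PiE)
    also have "coprime \<dots> p"
      using p JD by (intro prod_coprime_left cop) auto
    finally show "coprime (order ?H) p" .
  qed
  then show ?thesis ..
qed

section \<open>The outcome for each residue of the order\<close>

lemma (in group) min_gens_prime_order:
  assumes "Factorial_Ring.prime (order G)"
  shows "min_gens G = 1"
proof -
  have fin: "finite (carrier G)"
    using assms order_gt_0_iff_finite prime_gt_0_nat by metis
  have nontrivial: "carrier G \<noteq> {\<one>}"
    using assms order_one_triv_iff not_prime_1 by metis
  then obtain x where x: "x \<in> carrier G" "x \<noteq> \<one>"
    using one_closed by blast
  have sub: "subgroup (generate G {x}) G"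
    using x by (intro generate_is_subgroup) simp
  have "card (generate G {x}) dvd order G"
    using lagrange[OF sub] by (metis dvd_triv_right)
  moreover have "card (generate G {x}) \<noteq> 1"
  proof
    assume "card (generate G {x}) = 1"
    then obtain z where "generate G {x} = {z}"
      using card_1_singletonE by blast
    then show False
      using x(2) generate.one[of G "{x}"] generate.incl[of x "{x}" G] by simp
  qed
  ultimately have "card (generate G {x}) = card (carrier G)"
    using assms unfolding order_def prime_nat_iff by blast
  then have gen: "generate G {x} = carrier G"
    using fin subgroup.subset[OF sub] by (simp add: card_subset_eq)
  have "min_gens G \<le> 1"
    using min_gens_le[of "{x}"] gen x(1) by simp
  moreover obtain S where "S \<subseteq> carrier G" "finite S" "card S = min_gens G" "generate G S = carrier G"
    by (rule obtain_min_gens[OF fin])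
  then have "min_gens G \<noteq> 0"
    using nontrivial generate_empty by auto
  ultimately show ?thesis
    by simp
qed

context finite_nilpotent_group
begin

text \<open>
  Players 1 and 3 prefer Player 1 to win and need \<open>I\<close> filled; Player 2 alone needs \<open>J\<close> filled. Per round
  the coalition makes two moves and Player 2 makes one, so the lead compares \<open>deficiency G I\<close> with
  twice \<open>deficiency G J\<close>, up to an offset that depends on whose turn it is: Player 1 opens, so before
  the \<open>b\<close>-th move of Player 2 the coalition has made \<open>2 * b - 1\<close> moves.
\<close>

lemma two_against_one:
  assumes nontrivial: "generate G {} \<noteq> carrier G"
    and disj: "I \<inter> J = {}"
    and cover: "\<And>M. maximal_subgroup G M \<Longrightarrow> subgroup_index G M \<in> I \<union> J"
    and win_I: "\<And>M. maximal_subgroup G M \<Longrightarrow> subgroup_index G M \<in> I \<Longrightarrow>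
      winner_at (card M) = Player2"
    and win_J: "\<And>M. maximal_subgroup G M \<Longrightarrow> subgroup_index G M \<in> J \<Longrightarrow>
      winner_at (card M) = Player1"
  shows "deficiency G I {} + 1 \<le> 2 * deficiency G J {} \<Longrightarrow> has_winning_strategy G Player1"
    and "2 * deficiency G J {} < deficiency G I {} + 1 \<Longrightarrow> has_winning_strategy G Player2"
proof -
  have residue: "n mod 3 = 0 \<or> n mod 3 = 1 \<or> n mod 3 = 2" for n :: nat
    by presburger
  show "has_winning_strategy G Player1" if "deficiency G I {} + 1 \<le> 2 * deficiency G J {}"
  proof (rule race[OF nontrivial disj cover win_I win_J])
    let ?R = "\<lambda>(n::nat) a b. a + (if n mod 3 = 0 then 1 else if n mod 3 = 1 then 2 else 0) \<le> 2 * (b::nat)"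
    show "a = 0 \<or> ?R (Suc n) a b"
      if "place Player1 (turn n) \<le> place Player2 (turn n)" "?R n (Suc a) b" for n a b
      using residue[of n] that by (auto simp: place_def turn_mod mod_Suc)
    show "0 < b \<and> ?R (Suc n) (Suc a) b"
      if "place Player2 (turn n) < place Player1 (turn n)" "?R n (Suc a) (Suc b)" for n a b
      using residue[of n] that by (auto simp: place_def turn_mod mod_Suc)
    show "deficiency G I {} = 0 \<or> 0 < deficiency G J {} \<and> ?R 0 (deficiency G I {}) (deficiency G J {})"
      using that by simp
  qed auto
  show "has_winning_strategy G Player2" if "2 * deficiency G J {} < deficiency G I {} + 1"
  proof (rule race[OF nontrivial _ _ win_J win_I])
    let ?R = "\<lambda>(n::nat) a b. 2 * a + (if n mod 3 = 0 then 1 else if n mod 3 = 1 then 0 else 2) \<le> (b::nat) + 1"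
    show "J \<inter> I = {}" "\<And>M. maximal_subgroup G M \<Longrightarrow> subgroup_index G M \<in> J \<union> I"
      using disj cover by auto
    show "a = 0 \<or> ?R (Suc n) a b"
      if "place Player2 (turn n) \<le> place Player1 (turn n)" "?R n (Suc a) b" for n a b
      using residue[of n] that by (auto simp: place_def turn_mod mod_Suc)
    show "0 < b \<and> ?R (Suc n) (Suc a) b"
      if "place Player1 (turn n) < place Player2 (turn n)" "?R n (Suc a) (Suc b)" for n a b
      using residue[of n] that by (auto simp: place_def turn_mod mod_Suc)
    show "deficiency G J {} = 0 \<or> 0 < deficiency G I {} \<and> ?R 0 (deficiency G J {}) (deficiency G I {})"
      using that by (cases "deficiency G J {} = 0") auto
  qed auto
qed

lemma maximal_index_prime_divisor:
  assumes "maximal_subgroup G M"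
  shows "Factorial_Ring.prime (subgroup_index G M)" "subgroup_index G M dvd order G"
    "order G = subgroup_index G M * card M"
  using nilpotent_maximal_index[OF finite nilpotent assms] by (metis dvd_triv_left)+

text \<open>
  If \<open>3\<close> divides the order exactly once, a maximal subgroup of index \<open>3\<close> has order congruent to \<open>c\<close> modulo
  \<open>3\<close>, whereas all others have order divisible by \<open>3\<close> and let Player 3 win. A single element of order \<open>3\<close>
  fills \<open>{3}\<close> and so rules out index \<open>3\<close>. Those who want index \<open>3\<close> must therefore fill all other primes
  before any of their opponents moves: Player 1 alone if \<open>c = 1\<close>, and Players 1 and 2 together if
  \<open>c = 2\<close>. This succeeds exactly if one or two elements, respectively, suffice to generate the group.
\<close>

lemma one_prime_against_rest:
  assumes nontrivial: "generate G {} \<noteq> carrier G"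
    and one: "deficiency G {3} {} = 1" and mod9: "order G mod 9 = 3 * c" "c < 3"
  shows "c = 1 \<Longrightarrow> min_gens G \<le> 1 \<Longrightarrow> has_winning_strategy G Player1"
    and "c = 2 \<Longrightarrow> min_gens G \<le> 2 \<Longrightarrow> has_winning_strategy G Player2"
    and "c = 1 \<Longrightarrow> 2 \<le> min_gens G \<Longrightarrow> has_winning_strategy G Player3"
    and "c = 2 \<Longrightarrow> 3 \<le> min_gens G \<Longrightarrow> has_winning_strategy G Player3"
proof -
  let ?O = "- {3::nat}"
  have win_3: "winner_at (card M) = (if c = 1 then Player1 else if c = 2 then Player2 else Player3)"
    if "maximal_subgroup G M" "subgroup_index G M \<in> {3}" for M
  proof -
    have "order G = 3 * card M"
      using maximal_index_prime_divisor(3)[OF that(1)] that(2) by simp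
    then have "card M mod 3 = c"
      using mod9 mult_mod_right[of 3 "card M" 3] by simp
    then show ?thesis
      using mod9(2) by (auto simp: winner_at_mod)
  qed
  have win_O: "winner_at (card M) = Player3"
    if M: "maximal_subgroup G M" "subgroup_index G M \<in> ?O" for M
  proof -
    have "3 dvd order G"
      using dvd_mod_iff[of 3 9 "order G"] mod9(1) by simp
    then have "3 dvd subgroup_index G M * card M"
      using maximal_index_prime_divisor(3)[OF M(1)] by metis
    moreover have "Factorial_Ring.prime (3::nat)"
      by simp
    ultimately have "3 dvd subgroup_index G M \<or> 3 dvd card M"
      using prime_dvd_mult_iff by blast
    moreover have "\<not> 3 dvd subgroup_index G M"
      using maximal_index_prime_divisor(1)[OF M(1)] M(2) primes_dvd_imp_eq[of "3::nat"] by auto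
    ultimately show ?thesis
      by (auto simp: winner_at_mod)
  qed
  have cover: "subgroup_index G M \<in> {3} \<union> ?O" "subgroup_index G M \<in> ?O \<union> {3}" for M
    by auto
  have disj: "{3} \<inter> ?O = {}" "?O \<inter> {3} = {}"
    by auto
  \<comment> \<open>Filling the primes other than \<open>3\<close> takes as many selections as generating \<open>G\<close>, unless one element generates \<open>G\<close>.\<close>
  have O_le: "deficiency G ?O {} \<le> min_gens G"
    unfolding min_gens_eq_deficiency by (rule deficiency_mono) auto
  have "min_gens G \<le> max 1 (deficiency G ?O {})"
    unfolding min_gens_eq_deficiency
    using deficiency_Un_le[of "{}" "{3}" ?O "max 1 (deficiency G ?O {})"] one by simp
  then have O_ge: "2 \<le> k \<Longrightarrow> k \<le> min_gens G \<Longrightarrow> k \<le> deficiency G ?O {}" for k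
    by auto
  \<comment> \<open>The bounds on \<open>n\<close> below restrict the lead to the first round: a coalition that wants index
    \<open>3\<close> has to be done before an opponent moves, and its opponents stop it with their first move.\<close>
  show "has_winning_strategy G Player1" if "c = 1" "min_gens G \<le> 1"
  proof (rule race[OF nontrivial disj(2) cover(2), where R = "\<lambda>n a b. n = 0 \<and> a \<le> 1"])
    show "deficiency G ?O {} = 0 \<or>
        0 < deficiency G {3} {} \<and> (0::nat) = 0 \<and> deficiency G ?O {} \<le> 1"
      using O_le one that(2) by simp
  qed (use win_O win_3 that(1) in \<open>auto simp: place_def turn_def\<close>)
  show "has_winning_strategy G Player2" if "c = 2" "min_gens G \<le> 2"
  proof (rule race[OF nontrivial disj(2) cover(2), where R = "\<lambda>n a b. n + a \<le> 2"])
    show "0 < b \<and> Suc n + Suc a \<le> 2"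
      if "place Player3 (turn n) < place Player2 (turn n)" "n + Suc a \<le> 2" for n a and b :: nat
    proof -
      have "n = 0 \<or> n = 1"
        using that(2) by linarith
      then show ?thesis
        using that(1) by (auto simp: place_def turn_def)
    qed
    show "deficiency G ?O {} = 0 \<or> 0 < deficiency G {3} {} \<and> 0 + deficiency G ?O {} \<le> 2"
      using O_le one that(2) by simp
  qed (use win_O win_3 that(1) in auto)
  show "has_winning_strategy G Player3" if "c = 1" "2 \<le> min_gens G"
  proof (rule race[OF nontrivial disj(1) cover(1), where R = "\<lambda>n a b. a \<le> 1 \<and> n \<le> 1 \<and> 2 \<le> n + b"])
    show "0 < b \<and> Suc a \<le> 1 \<and> Suc n \<le> 1 \<and> 2 \<le> Suc n + b"
      if "place Player1 (turn n) < place Player3 (turn n)" "Suc a \<le> 1 \<and> n \<le> 1 \<and> 2 \<le> n + Suc b" for n a b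
    proof -
      have "n = 0 \<or> n = 1"
        using that(2) by linarith
      then show ?thesis
        using that by (auto simp: place_def turn_def)
    qed
    show "deficiency G {3} {} = 0 \<or> 0 < deficiency G ?O {} \<and>
        deficiency G {3} {} \<le> 1 \<and> (0::nat) \<le> 1 \<and> 2 \<le> 0 + deficiency G ?O {}"
      using O_ge[of 2] one that(2) by simp
  qed (use win_O win_3 that(1) in auto)
  show "has_winning_strategy G Player3" if "c = 2" "3 \<le> min_gens G"
  proof (rule race[OF nontrivial disj(1) cover(1), where R = "\<lambda>n a b. a \<le> 1 \<and> n \<le> 2 \<and> 3 \<le> n + b"])
    show "0 < b \<and> Suc a \<le> 1 \<and> Suc n \<le> 2 \<and> 3 \<le> Suc n + b"
      if "place Player2 (turn n) < place Player3 (turn n)" "Suc a \<le> 1 \<and> n \<le> 2 \<and> 3 \<le> n + Suc b" for n a b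
    proof -
      have "n = 0 \<or> n = 1 \<or> n = 2"
        using that(2) by linarith
      then show ?thesis
        using that by (auto simp: place_def turn_def numeral_2_eq_2)
    qed
    show "deficiency G {3} {} = 0 \<or> 0 < deficiency G ?O {} \<and>
        deficiency G {3} {} \<le> 1 \<and> (0::nat) \<le> 2 \<and> 3 \<le> 0 + deficiency G ?O {}"
      using O_ge[of 3] one that(2) by simp
  qed (use win_O win_3 that(1) in auto)
qed

text \<open>
  The order of every maximal subgroup is still divisible by \<open>3\<close>, because its index is a single prime.
  So all players can only reach the same outcome, and the lead in the race is never lost.
\<close>

lemma order_divisible_by_9:
  assumes nontrivial: "generate G {} \<noteq> carrier G" and "9 dvd order G"
  shows "has_winning_strategy G Player3"
proof -
  have win: "winner_at (card M) = Player3" if M: "maximal_subgroup G M" for M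
  proof -
    note p = maximal_index_prime_divisor[OF M]
    have "3 dvd card M"
    proof (cases "subgroup_index G M = 3")
      case True
      then show ?thesis
        using p(3) assms(2) by presburger
    next
      case False
      then have "coprime 3 (subgroup_index G M)"
        using primes_coprime[of "3::nat"] p(1) by auto
      moreover have "3 dvd subgroup_index G M * card M"
        using dvd_trans[of 3 9 "order G"] assms(2) by (simp flip: p(3))
      ultimately show ?thesis
        using coprime_dvd_mult_right_iff by blast
    qed
    then show ?thesis
      by (simp add: winner_at_mod dvd_eq_mod_eq_0)
  qed
  have "fills G {} {}"
    by (simp add: fills_def)
  then have "deficiency G {} {} = 0"
    using deficiency_eq_0 by simp
  then have start: "deficiency G {} {} = 0 \<or> 0 < deficiency G UNIV {} \<and> True"
    by simp
  show ?thesis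
    by (rule race[OF nontrivial, where I = "{}" and J = UNIV and v = Player3
          and R = "\<lambda>n a b. True", OF _ _ _ _ _ _ _ start]) (simp_all add: win)
qed

end

lemma residues_of_mult_mod_3:
  fixes p m c :: nat
  assumes "p * m mod 3 = c" "c = 1 \<or> c = 2"
  shows "p mod 3 = c \<and> m mod 3 = 1 \<or> p mod 3 = 3 - c \<and> m mod 3 = 2"
proof -
  have "(p mod 3) * (m mod 3) mod 3 = c"
    using assms(1) by (simp add: mod_mult_eq)
  moreover have "p mod 3 = 0 \<or> p mod 3 = 1 \<or> p mod 3 = 2" "m mod 3 = 0 \<or> m mod 3 = 1 \<or> m mod 3 = 2"
    by presburger+
  ultimately show ?thesis
    using assms(2) by (elim disjE) simp_all
qed

theorem theorem4p3:
  fixes G :: "('a, 'b) monoid_scheme" and P :: "nat \<Rightarrow> 'a set"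
    and H K :: "(nat \<Rightarrow> 'a) monoid"
  assumes "group G" and "finite (carrier G)" and "\<not> trivial_group G" and "nilpotent_group G"
    and "\<And>p. \<lbrakk>Factorial_Ring.prime p; p dvd order G\<rbrakk> \<Longrightarrow> sylow_subgroup G p (P p)"
    and "H = product_group {q. Factorial_Ring.prime q \<and> q dvd order G \<and> [q = 1] (mod 3)}
               (\<lambda>q. G\<lparr>carrier := P q\<rparr>)"
    and "K = product_group {r. Factorial_Ring.prime r \<and> r dvd order G \<and> [r = 2] (mod 3)}
               (\<lambda>r. G\<lparr>carrier := P r\<rparr>)"
  shows
    "([order G = 1] (mod 3) \<and> 2 * min_gens H \<ge> min_gens K + 1 \<longrightarrow> has_winning_strategy G Player1) \<and>
     ([order G = 2] (mod 3) \<and> 2 * min_gens K \<ge> min_gens H + 1 \<longrightarrow> has_winning_strategy G Player1) \<and>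
     ([order G = 3] (mod 9) \<and> min_gens G = 1 \<longrightarrow> has_winning_strategy G Player1) \<and>
     ([order G = 1] (mod 3) \<and> 2 * min_gens H < min_gens K + 1 \<longrightarrow> has_winning_strategy G Player2) \<and>
     ([order G = 2] (mod 3) \<and> 2 * min_gens K < min_gens H + 1 \<longrightarrow> has_winning_strategy G Player2) \<and>
     ([order G = 6] (mod 9) \<and> min_gens G \<le> 2 \<longrightarrow> has_winning_strategy G Player2) \<and>
     ([order G = 0] (mod 9) \<longrightarrow> has_winning_strategy G Player3) \<and>
     ([order G = 3] (mod 9) \<and> min_gens G \<ge> 2 \<longrightarrow> has_winning_strategy G Player3) \<and>
     ([order G = 6] (mod 9) \<and> min_gens G \<ge> 3 \<longrightarrow> has_winning_strategy G Player3)"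
proof -
  interpret finite_nilpotent_group G
    using assms(1,2,4) by (simp add: finite_nilpotent_group_def finite_nilpotent_group_axioms_def)
  let ?D = "{p. Factorial_Ring.prime p \<and> p dvd order G}"
  let ?I = "\<lambda>c. {q. Factorial_Ring.prime q \<and> q dvd order G \<and> [q = c] (mod 3)}"
  have nontrivial: "generate G {} \<noteq> carrier G"
    using assms(1,3) by (auto simp: trivial_group_def generate_empty)
  have sylow: "min_gens (product_group J (\<lambda>p. G\<lparr>carrier := P p\<rparr>)) = deficiency G J {}"
    if "J \<subseteq> ?D" for J
    using min_gens_sylow_product[of P J] assms(5) that by blast
  have H: "min_gens H = deficiency G (?I 1) {}" and K: "min_gens K = deficiency G (?I 2) {}"
    unfolding assms(6,7) by (rule sylow; blast)+
  have disj: "?I 1 \<inter> ?I 2 = {}" "?I 2 \<inter> ?I 1 = {}"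
    by (auto simp: cong_def)
  have winner: "subgroup_index G M \<in> ?I 1 \<union> ?I 2"
    "subgroup_index G M \<in> ?I c \<Longrightarrow> winner_at (card M) = Player1"
    "subgroup_index G M \<in> ?I d \<Longrightarrow> d \<noteq> c \<Longrightarrow> winner_at (card M) = Player2"
    if c: "[order G = c] (mod 3)" "c = 1 \<or> c = 2" and M: "maximal_subgroup G M"
      and d: "d = 1 \<or> d = 2" for M c d
  proof -
    note p = maximal_index_prime_divisor[OF M]
    have "subgroup_index G M * card M mod 3 = c"
      using c p(3) by (auto simp: cong_def)
    then have residues: "subgroup_index G M mod 3 = c \<and> card M mod 3 = 1 \<or>
        subgroup_index G M mod 3 = 3 - c \<and> card M mod 3 = 2"
      using residues_of_mult_mod_3[OF _ c(2)] by blast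
    have mem: "subgroup_index G M \<in> ?I k \<longleftrightarrow> subgroup_index G M mod 3 = k mod 3" for k
      using p(1,2) by (simp add: cong_def)
    show "subgroup_index G M \<in> ?I 1 \<union> ?I 2"
      using residues c(2) unfolding Un_iff mem by (elim disjE) simp_all
    show "winner_at (card M) = Player1" if "subgroup_index G M \<in> ?I c"
      using residues c(2) that unfolding mem winner_at_mod by (elim disjE) simp_all
    show "winner_at (card M) = Player2" if "subgroup_index G M \<in> ?I d" "d \<noteq> c"
      using residues c(2) d that unfolding mem winner_at_mod by (elim disjE) simp_all
  qed
  have case1: "min_gens K + 1 \<le> 2 * min_gens H \<Longrightarrow> has_winning_strategy G Player1"
    "2 * min_gens H < min_gens K + 1 \<Longrightarrow> has_winning_strategy G Player2"
    if c: "[order G = 1] (mod 3)"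
  proof -
    have cover: "subgroup_index G M \<in> ?I 2 \<union> ?I 1" if "maximal_subgroup G M" for M
      using winner(1)[OF c _ that] by auto
    have win: "subgroup_index G M \<in> ?I 2 \<Longrightarrow> winner_at (card M) = Player2"
      "subgroup_index G M \<in> ?I 1 \<Longrightarrow> winner_at (card M) = Player1" if "maximal_subgroup G M" for M
      using winner(2,3)[OF c _ that, of 2] by simp_all
    note race = two_against_one[OF nontrivial disj(2) cover win]
    show "min_gens K + 1 \<le> 2 * min_gens H \<Longrightarrow> has_winning_strategy G Player1"
      "2 * min_gens H < min_gens K + 1 \<Longrightarrow> has_winning_strategy G Player2"
      unfolding H K using race by blast+
  qed
  have case2: "min_gens H + 1 \<le> 2 * min_gens K \<Longrightarrow> has_winning_strategy G Player1"
    "2 * min_gens K < min_gens H + 1 \<Longrightarrow> has_winning_strategy G Player2"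
    if c: "[order G = 2] (mod 3)"
  proof -
    have cover: "subgroup_index G M \<in> ?I 1 \<union> ?I 2" if "maximal_subgroup G M" for M
      using winner(1)[OF c _ that] by auto
    have win: "subgroup_index G M \<in> ?I 1 \<Longrightarrow> winner_at (card M) = Player2"
      "subgroup_index G M \<in> ?I 2 \<Longrightarrow> winner_at (card M) = Player1" if "maximal_subgroup G M" for M
      using winner(2,3)[OF c _ that, of 1] by simp_all
    note race = two_against_one[OF nontrivial disj(1) cover win]
    show "min_gens H + 1 \<le> 2 * min_gens K \<Longrightarrow> has_winning_strategy G Player1"
      "2 * min_gens K < min_gens H + 1 \<Longrightarrow> has_winning_strategy G Player2"
      unfolding H K using race by blast+
  qed
  have one: "deficiency G {3} {} = 1" if c: "order G mod 9 = 3 * c" "c = 1 \<or> c = 2" for c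
  proof -
    have "order G mod 9 = 3 \<or> order G mod 9 = 6"
      using c by auto
    then have dvd: "3 dvd order G" and ndvd: "\<not> 9 dvd order G"
      by presburger+
    have mult: "multiplicity 3 (order G) = 1"
      using dvd ndvd by (intro multiplicity_eqI) (simp_all add: numeral_2_eq_2)
    have S: "subgroup (P 3) G" "card (P 3) = 3"
      using assms(5)[of 3] dvd mult unfolding sylow_subgroup_def by auto
    let ?Q = "product_group {3} (\<lambda>p. G\<lparr>carrier := P p\<rparr>)"
    have "group ?Q"
      using subgroup_imp_group[OF S(1)] by (intro product_group) simp
    moreover have "order ?Q = 3"
      using S(2) by (simp add: order_def card_PiE)
    ultimately have "min_gens ?Q = 1"
      using group.min_gens_prime_order[of ?Q] by simp
    then show ?thesis
      using sylow[of "{3}"] dvd by simp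
  qed
  have case3: "min_gens G = 1 \<Longrightarrow> has_winning_strategy G Player1"
    "2 \<le> min_gens G \<Longrightarrow> has_winning_strategy G Player3" if "[order G = 3] (mod 9)"
    using one_prime_against_rest[OF nontrivial one, of 1] that by (simp_all add: cong_def)
  have case6: "min_gens G \<le> 2 \<Longrightarrow> has_winning_strategy G Player2"
    "3 \<le> min_gens G \<Longrightarrow> has_winning_strategy G Player3" if "[order G = 6] (mod 9)"
    using one_prime_against_rest[OF nontrivial one, of 2] that by (simp_all add: cong_def)
  have case0: "has_winning_strategy G Player3" if "[order G = 0] (mod 9)"
    using order_divisible_by_9[OF nontrivial] that by (simp add: cong_0_iff)
  show ?thesis
    using case1 case2 case3 case6 case0 by blast
qed

end
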